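(* Let $k\geq 5$ be an integer and let $G=K_{3*3,2*(k-5),1*2}$, i.e. the complete $k$-partite graph having exactly three parts of size $3$, $k-5$ parts of size $2$, and two parts of size $1$. Then $Ch(G)=k$.
   Context: Graphs are finite and simple. A complete multipartite graph is one whose vertex set is partitioned into parts such that two vertices are adjacent if and only if they lie in different parts. In the notation $K_{\ldots}$, an entry $r*s$ means that there are $s$ parts of size $r$. For a graph $G=(V,E)$, a list assignment $L$ assigns to each vertex $u\in V$ a set $L(u)$ of colors; it is a $k$-list assignment if $|L(u)|\geq k$ for every $u\in V$. An $L$-coloring of $G$ is a coloring in which each vertex $u$ receives a color from $L(u)$ and adjacent vertices receive different colors. $G$ is $L$-colorable if it has an $L$-coloring. $G$ is $k$-choosable if it is $L$-colorable for every $k$-list assignment $L$. The choice number $Ch(G)$ is the smallest integer $k$ such that $G$ is $k$-choosable. *)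

theory Defs
  imports "Graph_Theory.Digraph" "HOL-Library.Disjoint_Sets" "HOL-Library.Multiset"
begin

text \<open>
  A finite simple graph is a digraph satisfying the locale \<^locale>\<open>graph\<close>: finite, loop-free,
  without parallel arcs, and with a symmetric adjacency relation \<^const>\<open>arcs_ends\<close>.

  The multiset \<open>S\<close> holds the part sizes with multiplicity, so that an entry \<open>r*s\<close> in the
  notation \<open>K\<^bsub>\<dots>\<^esub>\<close> contributes \<open>replicate_mset s r\<close>. Parts are nonempty by
  \<^const>\<open>partition_on\<close>.
\<close>
definition complete_multipartite :: "nat multiset \<Rightarrow> ('a, 'b) pre_digraph \<Rightarrow> bool" where
  "complete_multipartite S G \<longleftrightarrow> graph G \<and>
     (\<exists>P. partition_on (verts G) P \<and> image_mset card (mset_set P) = S \<and>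
          (\<forall>A\<in>P. \<forall>B\<in>P. \<forall>u\<in>A. \<forall>v\<in>B. u \<rightarrow>\<^bsub>G\<^esub> v \<longleftrightarrow> A \<noteq> B))"

text \<open>Lists may be infinite; as \<^const>\<open>card\<close> is 0 on infinite sets, that case is separate.\<close>
definition list_assignment :: "nat \<Rightarrow> ('a, 'b) pre_digraph \<Rightarrow> ('a \<Rightarrow> 'c set) \<Rightarrow> bool" where
  "list_assignment k G L \<longleftrightarrow> (\<forall>u\<in>verts G. infinite (L u) \<or> k \<le> card (L u))"

definition list_coloring :: "('a, 'b) pre_digraph \<Rightarrow> ('a \<Rightarrow> 'c set) \<Rightarrow> ('a \<Rightarrow> 'c) \<Rightarrow> bool" where
  "list_coloring G L c \<longleftrightarrow>
     (\<forall>u\<in>verts G. c u \<in> L u) \<and> (\<forall>u v. u \<rightarrow>\<^bsub>G\<^esub> v \<longrightarrow> c u \<noteq> c v)"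

definition list_colorable :: "('a, 'b) pre_digraph \<Rightarrow> ('a \<Rightarrow> 'c set) \<Rightarrow> bool" where
  "list_colorable G L \<longleftrightarrow> (\<exists>c. list_coloring G L c)"

text \<open>
  A definition cannot quantify over the type of colors, so it is fixed to \<^typ>\<open>nat\<close>. For finite
  graphs this loses nothing: see \<open>choosable_any_colors\<close> below.
\<close>
definition choosable :: "nat \<Rightarrow> ('a, 'b) pre_digraph \<Rightarrow> bool" where
  "choosable k G \<longleftrightarrow>
     (\<forall>L :: 'a \<Rightarrow> nat set. list_assignment k G L \<longrightarrow> list_colorable G L)"

definition choice_number :: "('a, 'b) pre_digraph \<Rightarrow> nat" where
  "choice_number G = (LEAST k. choosable k G)"

lemma choosable_any_colors:
  fixes G :: "('a, 'b) pre_digraph" and L :: "'a \<Rightarrow> 'c set"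
  assumes "graph G" and "choosable k G" and L: "list_assignment k G L"
  shows "list_colorable G L"
proof -
  interpret graph G by fact
  have "\<exists>T. T \<subseteq> L u \<and> finite T \<and> card T = k" if "u \<in> verts G" for u
    using L that infinite_arbitrarily_large[of "L u" k] obtain_subset_with_card_n[of k "L u"]
    unfolding list_assignment_def by (metis card_ge_0_finite finite.emptyI
        card.empty empty_subsetI le_zero_eq not_gr_zero)
  then obtain T where T: "T u \<subseteq> L u" "finite (T u)" "card (T u) = k" if "u \<in> verts G" for u
    by metis
  have "finite (\<Union>u\<in>verts G. T u)"
    using T by auto
  then obtain f :: "'c \<Rightarrow> nat" where f: "inj_on f (\<Union>u\<in>verts G. T u)"
    using finite_imp_inj_to_nat_seg by metis
  have "inj_on f (T u)" if "u \<in> verts G" for u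
    using f by (rule inj_on_subset) (use that in blast)
  then have "list_assignment k G (\<lambda>u. f ` T u)"
    unfolding list_assignment_def by (simp add: card_image T)
  then obtain c where c: "list_coloring G (\<lambda>u. f ` T u) c"
    using \<open>choosable k G\<close> unfolding choosable_def list_colorable_def by blast
  then obtain d where d: "d u \<in> T u" "c u = f (d u)" if "u \<in> verts G" for u
    unfolding list_coloring_def image_iff by metis
  have "d u \<noteq> d v" if "u \<rightarrow>\<^bsub>G\<^esub> v" for u v
  proof -
    have "u \<in> verts G" "v \<in> verts G" "c u \<noteq> c v"
      using that c unfolding list_coloring_def by auto
    then show ?thesis using d by metis
  qed
  then have "list_coloring G L d"
    using d(1) T(1) unfolding list_coloring_def by blast
  then show ?thesis unfolding list_colorable_def by blast
qed

end

theory Submission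
  imports Defs
begin

text \<open>
  By Hall's theorem, a non-colourable list assignment with list sizes below the number of vertices
  can be replaced by one in which the lists together contain fewer colours than there are vertices.
  Hence every part of size 2 whose two list sizes add up to at least the number of vertices may be
  assumed to have a common colour; using this colour on it removes the part, and all other lists
  lose at most one colour.

  For \<open>K\<^bsub>3*3,2*(k-5),1*2\<^esub>\<close> there are \<open>2k + 1\<close> vertices, so at most \<open>2k\<close> colours. If a part of size 2 has
  a common colour, induct on the number of these parts. If a part of size 3 has a common colour,
  use it there; the parts of size 2 can then be removed as above, which leaves \<open>K\<^bsub>3*2,1*2\<^esub>\<close> with lists of
  size 4. Otherwise \<open>3k > 2k\<close> forces two vertices of a part of size 3 to share a colour that the
  third one misses. After using it, the two lists on each part of size 2 have total size at least
  \<open>2k - 1\<close>, the new number of vertices, so these parts can again be removed, and the remaining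
  instance is \<open>K\<^bsub>3*2,1*3\<^esub>\<close> with lists of sizes 4 and 5. The small instances are coloured by
  repeatedly using a colour on a single vertex, on two vertices of a triple or on a whole triple,
  so that suitable lower bounds on the list sizes persist.
\<close>

section \<open>Colouring steps and greedy colouring\<close>

text \<open>The parts are the fibres of \<open>p\<close>, so subgraphs are handled by shrinking \<open>V\<close> only.\<close>
definition mcol :: "('a \<Rightarrow> 'b) \<Rightarrow> 'a set \<Rightarrow> ('a \<Rightarrow> 'c set) \<Rightarrow> bool" where
  "mcol p V L \<longleftrightarrow>
     (\<exists>c. (\<forall>v\<in>V. c v \<in> L v) \<and> (\<forall>u\<in>V. \<forall>v\<in>V. p u \<noteq> p v \<longrightarrow> c u \<noteq> c v))"

lemma mcol_subset: "mcol p W L \<Longrightarrow> V \<subseteq> W \<Longrightarrow> mcol p V L"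
  unfolding mcol_def by (meson subsetD)

text \<open>The vertices of \<open>I\<close> lie in one part, so they may all receive
  \<open>c\<close>, and the rest avoids \<open>c\<close> because it has been deleted there. Since
  only \<open>V \<subseteq> W \<union> I\<close> is asked, \<open>W\<close> and \<open>I\<close> may
  overlap; \<open>c\<close> then overrides the colouring of \<open>W\<close>. All later colourings
  are chains of such steps.\<close>

lemma mcol_step:
  assumes "mcol p W (\<lambda>v. L v - {c})" and "V \<subseteq> W \<union> I"
    and "\<And>v. v \<in> I \<Longrightarrow> c \<in> L v" and "\<And>u v. u \<in> I \<Longrightarrow> v \<in> I \<Longrightarrow> p u = p v"
  shows "mcol p V L"
proof -
  obtain f where f: "\<And>v. v \<in> W \<Longrightarrow> f v \<in> L v - {c}"
      "\<And>u v. u \<in> W \<Longrightarrow> v \<in> W \<Longrightarrow> p u \<noteq> p v \<Longrightarrow> f u \<noteq> f v"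
    using assms(1) unfolding mcol_def by metis
  let ?g = "\<lambda>v. if v \<in> I then c else f v"
  have "?g v \<in> L v" if "v \<in> V" for v
    using that assms(2,3) f(1) by auto
  moreover have "?g u \<noteq> ?g v" if "u \<in> V" "v \<in> V" "p u \<noteq> p v" for u v
    using that assms(2,4) f by (smt (verit) DiffE Un_iff insert_iff subsetD)
  ultimately show ?thesis
    unfolding mcol_def by (intro exI[of _ ?g]) blast
qed

lemma mcol_last:
  assumes "mcol p V L" "finite V" "card V < card (L v)"
  shows "mcol p (insert v V) L"
proof (cases "v \<in> V")
  case True
  then show ?thesis using assms(1) by (simp add: insert_absorb)
next
  case False
  obtain f where f: "\<And>v. v \<in> V \<Longrightarrow> f v \<in> L v"
      "\<And>u v. u \<in> V \<Longrightarrow> v \<in> V \<Longrightarrow> p u \<noteq> p v \<Longrightarrow> f u \<noteq> f v"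
    using assms(1) unfolding mcol_def by metis
  have "card (f ` V) < card (L v)"
    using card_image_le[OF assms(2), of f] assms(3) by simp
  then have "\<not> L v \<subseteq> f ` V"
    using assms(2) by (meson card_mono finite_imageI leD)
  then obtain d where "d \<in> L v" "d \<notin> f ` V"
    by blast
  have "(f(v := d)) u \<in> L u" if "u \<in> insert v V" for u
    using that f(1) \<open>d \<in> L v\<close> by auto
  moreover have "(f(v := d)) a \<noteq> (f(v := d)) b"
    if "a \<in> insert v V" "b \<in> insert v V" "p a \<noteq> p b" for a b
    using that f(2) \<open>d \<notin> f ` V\<close> by (cases "a = v"; cases "b = v") auto
  ultimately show ?thesis
    unfolding mcol_def by blast
qed

lemma mcol_empty: "mcol p {} L"
  unfolding mcol_def by simp

lemma mcol_part:
  assumes "\<And>v. v \<in> V \<Longrightarrow> L v \<noteq> {}" and "\<And>u v. u \<in> V \<Longrightarrow> v \<in> V \<Longrightarrow> p u = p v"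
  shows "mcol p V L"
proof -
  have "\<forall>v\<in>V. (SOME d. d \<in> L v) \<in> L v"
    using assms(1) by (simp add: some_in_eq)
  then show ?thesis
    using assms(2) unfolding mcol_def by (intro exI[of _ "\<lambda>v. SOME d. d \<in> L v"]) blast
qed

text \<open>The condition for colouring \<open>as\<close> greedily in the given order when at most
  \<open>n - 1\<close> colours are already in use. For positive \<open>n\<close> it also makes the
  lists finite, since an infinite set has \<open>card\<close> 0.\<close>

fun rising :: "('a \<Rightarrow> 'c set) \<Rightarrow> nat \<Rightarrow> 'a list \<Rightarrow> bool" where
  "rising L n [] = True"
| "rising L n (a # as) = (n \<le> card (L a) \<and> rising L (Suc n) as)"

lemma rising_antimono: "rising L m as \<Longrightarrow> n \<le> m \<Longrightarrow> rising L n as"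
  by (induction as arbitrary: m n) auto

lemma card_del_ge: "card A - 1 \<le> card (A - {c})"
  by (simp add: card_Diff_singleton_if)

text \<open>Positivity of \<open>card A\<close> stands for being finite and nonempty; for an
  infinite set containing \<open>c\<close> both cardinalities are 0 and the equation fails.\<close>

lemma card_del: "0 < card A \<Longrightarrow> card A = card (A - {c}) + (if c \<in> A then 1 else 0)"
  by (simp add: card_Diff_singleton_if)

lemma rising_del: "rising L (Suc n) as \<Longrightarrow> rising (\<lambda>v. L v - {c}) n as"
proof (induction as arbitrary: n)
  case (Cons a as)
  then show ?case
    using card_del_ge[of "L a" c] by auto
qed simp

lemma rising_mcol:
  "mcol p V L \<Longrightarrow> finite V \<Longrightarrow> rising L (Suc (card V)) as \<Longrightarrow> mcol p (V \<union> set as) L"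
proof (induction as arbitrary: V)
  case (Cons a as)
  have "mcol p (insert a V) L"
    using Cons.prems by (intro mcol_last) auto
  moreover have "rising L (Suc (card (insert a V))) as"
    using Cons.prems by (auto intro: rising_antimono simp: card_insert_if)
  ultimately have "mcol p (insert a V \<union> set as) L"
    using Cons.IH Cons.prems(2) by blast
  then show ?case by simp
qed simp

lemma rising_mcol_empty: "rising L 1 as \<Longrightarrow> mcol p (set as) L"
  using rising_mcol[OF mcol_empty, of L as p] by simp

section \<open>One triple with single vertices\<close>

lemma two_elements: "2 \<le> card A \<Longrightarrow> \<exists>a b. a \<in> A \<and> b \<in> A \<and> a \<noteq> b"
  by (metis card_le_Suc0_iff_eq card.infinite not_less_eq_eq numeral_2_eq_2 zero_le)

text \<open>
  The induction removes the first single vertex. This fails only if a pair of the triple is tight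
  and shares a colour; then the third list is so long that its vertex can be coloured last.
\<close>
lemma triple_one:
  assumes "p x = p y" "p y = p z" and "rising L 2 as"
    and "1 \<le> card (L x)" "1 \<le> card (L y)" "1 \<le> card (L z)"
    and "2 + length as \<le> card (L x) + card (L y)"
    and "2 + length as \<le> card (L x) + card (L z)"
    and "2 + length as \<le> card (L y) + card (L z)"
    and "3 + 2 * length as \<le> card (L x) + card (L y) + card (L z)"
  shows "mcol p ({x, y, z} \<union> set as) L"
  using assms(3-)
proof (induction as arbitrary: L)
  case Nil
  then have "L x \<noteq> {}" "L y \<noteq> {}" "L z \<noteq> {}" by auto
  then show ?case using assms(1,2) by (intro mcol_part) auto
next
  case (Cons a as)
  let ?Q = "Suc (length as)"
  have sing: "rising (\<lambda>v. L v - {c}) 1 (a # as)" for c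
    using Cons.prems(1) rising_del[of L 1 "a # as" c] by (simp add: numeral_2_eq_2)
  show ?case
  proof (cases "\<exists>c. c \<in> L x \<and> c \<in> L y \<and> c \<in> L z")
    case True
    then obtain c where "c \<in> L x" "c \<in> L y" "c \<in> L z" by blast
    then show ?thesis
      using assms(1,2)
      by (intro mcol_step[OF rising_mcol_empty[OF sing[of c]], where I = "{x, y, z}"]) auto
  next
    case nofull: False
    have tight: "mcol p ({x, y, z} \<union> set (a # as)) L"
      if "{u, v, w} = {x, y, z}" "c \<in> L u" "c \<in> L v" "c \<notin> L w"
        "Suc ?Q \<le> card (L w)" for u v w c
    proof (rule mcol_step)
      have "card (set (a # as)) \<le> ?Q"
        using card_length[of "a # as"] by simp
      then show "mcol p (insert w (set (a # as))) (\<lambda>v. L v - {c})"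
        using that by (intro mcol_last rising_mcol_empty sing) auto
      show "{x, y, z} \<union> set (a # as) \<subseteq> insert w (set (a # as)) \<union> {u, v}"
        using that(1) by auto
      show "p b = p d" if "b \<in> {u, v}" "d \<in> {u, v}" for b d
      proof -
        have "b \<in> {x, y, z}" "d \<in> {x, y, z}" using that \<open>{u, v, w} = {x, y, z}\<close> by auto
        then show ?thesis using assms(1,2) by auto
      qed
    qed (use that in auto)
    consider (xy) c where "c \<in> L x" "c \<in> L y" "Suc ?Q \<le> card (L z)"
      | (xz) c where "c \<in> L x" "c \<in> L z" "Suc ?Q \<le> card (L y)"
      | (yz) c where "c \<in> L y" "c \<in> L z" "Suc ?Q \<le> card (L x)"
      | (slack) "\<And>c. \<not> (c \<in> L x \<and> c \<in> L y \<and> Suc ?Q \<le> card (L z))"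
          "\<And>c. \<not> (c \<in> L x \<and> c \<in> L z \<and> Suc ?Q \<le> card (L y))"
          "\<And>c. \<not> (c \<in> L y \<and> c \<in> L z \<and> Suc ?Q \<le> card (L x))"
      by blast
    then show ?thesis
    proof cases
      case (xy c)
      then show ?thesis using nofull by (intro tight[of x y z c]) auto
    next
      case (xz c)
      then show ?thesis using nofull by (intro tight[of x z y c]) auto
    next
      case (yz c)
      then show ?thesis using nofull by (intro tight[of y z x c]) auto
    next
      case slack
      \<comment> \<open>Two candidates for \<open>a\<close> suffice: all pair sums are at least 3,
        so at most one list of the triple is a singleton, and one of the two colours empties no
        list.\<close>
      obtain c1 c2 where c12: "c1 \<in> L a" "c2 \<in> L a" "c1 \<noteq> c2"
        using Cons.prems(1) two_elements[of "L a"] by auto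
      have pairs: "3 \<le> card (L x) + card (L y)" "3 \<le> card (L x) + card (L z)"
          "3 \<le> card (L y) + card (L z)"
        using Cons.prems by auto
      have one: "card (L v) = 1" if "L v = {c}" for v c
        using that by simp
      have "(L x \<noteq> {c1} \<and> L y \<noteq> {c1} \<and> L z \<noteq> {c1}) \<or> (L x \<noteq> {c2} \<and> L y \<noteq> {c2} \<and> L z \<noteq> {c2})"
      proof (rule ccontr)
        assume "\<not> ?thesis"
        then have "card (L x) = 1 \<and> card (L y) = 1 \<or> card (L x) = 1 \<and> card (L z) = 1
            \<or> card (L y) = 1 \<and> card (L z) = 1"
          using c12(3) one by (metis singleton_inject)
        then show False using pairs by auto
      qed
      then obtain c where c: "c \<in> L a" "L x \<noteq> {c}" "L y \<noteq> {c}" "L z \<noteq> {c}"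
        using c12 by blast
      have big: "c \<in> L v \<Longrightarrow> 2 \<le> card (L v)" if "v \<in> {x, y, z}" for v
      proof -
        assume "c \<in> L v"
        then have "card (L v) \<noteq> 1" using c(2-4) that by (auto simp: card_1_singleton_iff)
        moreover have "card (L v) \<ge> 1" using that Cons.prems by auto
        ultimately show ?thesis by linarith
      qed
      have big': "c \<in> L x \<Longrightarrow> 2 \<le> card (L x)" "c \<in> L y \<Longrightarrow> 2 \<le> card (L y)"
          "c \<in> L z \<Longrightarrow> 2 \<le> card (L z)"
        using big by auto
      have nofull': "\<not> (c \<in> L x \<and> c \<in> L y \<and> c \<in> L z)"
        using nofull by blast
      define n where "n v = card (L v - {c})" for v
      have n: "card (L v) = n v + (if c \<in> L v then 1 else 0)" if "v \<in> {x, y, z}" for v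
        unfolding n_def by (rule card_del) (use that Cons.prems(2-4) in auto)
      \<comment> \<open>A pair loses two colours only if \<open>c\<close> is in both of its lists.
        Then \<open>slack\<close> bounds the third list by \<open>?Q\<close>, and the total
        \<open>3 + 2 * ?Q\<close> leaves at least \<open>3 + ?Q\<close> for the pair before the
        loss. The total loses at most 2 by \<open>nofull'\<close>.\<close>
      have "1 \<le> n x \<and> 1 \<le> n y \<and> 1 \<le> n z \<and> 2 + length as \<le> n x + n y
          \<and> 2 + length as \<le> n x + n z \<and> 2 + length as \<le> n y + n z
          \<and> 3 + 2 * length as \<le> n x + n y + n z"
        using Cons.prems(2-) big' slack[of c] nofull' n[of x] n[of y] n[of z]
        by (cases "c \<in> L x"; cases "c \<in> L y"; cases "c \<in> L z"; simp)
      moreover have "rising (\<lambda>v. L v - {c}) 2 as"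
        using Cons.prems(1) rising_del[of L 2 as c] by (simp add: eval_nat_numeral)
      ultimately have "mcol p ({x, y, z} \<union> set as) (\<lambda>v. L v - {c})"
        unfolding n_def by (intro Cons.IH) blast+
      then show ?thesis
        by (rule mcol_step[where I = "{a}"]) (use c in auto)
    qed
  qed
qed

section \<open>Two triples without single vertices\<close>

text \<open>Each singleton list rules out only one element of \<open>A\<close>.\<close>

lemma avoid_singletons:
  assumes "finite Y" "card {y \<in> Y. card (L y) = 1} < card A"
  shows "\<exists>t\<in>A. \<forall>y\<in>Y. L y \<noteq> {t}"
proof -
  let ?S = "(\<lambda>y. the_elem (L y)) ` {y \<in> Y. card (L y) = 1}"
  have "finite ?S" "card ?S < card A"
    using assms card_image_le[of "{y \<in> Y. card (L y) = 1}" "\<lambda>y. the_elem (L y)"] by auto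
  then have "\<not> A \<subseteq> ?S"
    using card_mono by (metis leD)
  then obtain t where t: "t \<in> A" "t \<notin> ?S" by blast
  have "L y \<noteq> {t}" if "y \<in> Y" for y
  proof
    assume "L y = {t}"
    then have "t = the_elem (L y)" "card (L y) = 1" by auto
    then show False using t(2) that by blast
  qed
  then show ?thesis using t(1) by blast
qed

lemma card_three_filter:
  "card {y \<in> {a, b, c}. P y}
    \<le> (if P a then 1 else 0) + (if P b then 1 else 0) + (if P c then 1 else (0::nat))"
proof -
  have "{y \<in> {a, b, c}. P y} =
      (if P a then {a} else {}) \<union> (if P b then {b} else {}) \<union> (if P c then {c} else {})"
    by auto
  moreover have "card ((if P a then {a} else {}) \<union> (if P b then {b} else {}) \<union> (if P c then {c} else {}))
     \<le> card (if P a then {a} else {}) + card (if P b then {b} else {}) + card (if P c then {c} else {})"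
    using card_Un_le[of "(if P a then {a} else {}) \<union> (if P b then {b} else {})" "if P c then {c} else {}"]
      card_Un_le[of "if P a then {a} else {}" "if P b then {b} else {}"]
    by linarith
  ultimately show ?thesis by (simp split: if_splits)
qed

lemma card_three_filter_le2:
  "\<not> (P a \<and> P b \<and> P c) \<Longrightarrow> card {y \<in> {a, b, c}. P y} \<le> 2"
  by (rule order_trans[OF card_three_filter]) simp

lemma card_three_filter_le1:
  "\<not> (P a \<and> P b) \<Longrightarrow> \<not> (P a \<and> P c) \<Longrightarrow> \<not> (P b \<and> P c) \<Longrightarrow>
    card {y \<in> {a, b, c}. P y} \<le> 1"
  by (rule order_trans[OF card_three_filter]) simp

text \<open>The graph is a star with centre \<open>x\<close>: it is enough to give \<open>x\<close>
  a colour that is not the only one on any leaf.\<close>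

lemma mcol_cone:
  assumes "\<And>u v. u \<in> Y \<Longrightarrow> v \<in> Y \<Longrightarrow> p u = p v" "finite Y"
    and "\<And>y. y \<in> Y \<Longrightarrow> L y \<noteq> {}" "card {y \<in> Y. card (L y) = 1} < card (L x)"
  shows "mcol p (insert x Y) L"
proof -
  obtain t where t: "t \<in> L x" "\<And>y. y \<in> Y \<Longrightarrow> L y \<noteq> {t}"
    using avoid_singletons[OF assms(2,4)] by blast
  have "L y - {t} \<noteq> {}" if "y \<in> Y" for y
    using assms(3)[OF that] t(2)[OF that] by blast
  then have "mcol p Y (\<lambda>v. L v - {t})"
    by (intro mcol_part assms(1))
  then show ?thesis
    by (rule mcol_step[where I = "{x}"]) (use t in auto)
qed

text \<open>Using \<open>c\<close> on \<open>u\<close> and \<open>v\<close> leaves a star with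
  centre \<open>w\<close>, whose list is unchanged.\<close>

lemma two_triples_pair:
  assumes p: "p u = p v" "p v = p w" "p y1 = p y2" "p y2 = p y3"
    and c: "c \<in> L u" "c \<in> L v" "c \<notin> L w"
    and "L y1 - {c} \<noteq> {}" "L y2 - {c} \<noteq> {}" "L y3 - {c} \<noteq> {}"
    and "card {y \<in> {y1, y2, y3}. card (L y - {c}) = 1} < card (L w)"
  shows "mcol p {u, v, w, y1, y2, y3} L"
proof -
  have "mcol p (insert w {y1, y2, y3}) (\<lambda>v. L v - {c})"
    using assms by (intro mcol_cone) auto
  then show ?thesis
    by (rule mcol_step[where I = "{u, v}"]) (use p c in auto)
qed

text \<open>If using \<open>c\<close> on \<open>u\<close> and \<open>v\<close> fails, then deleting
  \<open>c\<close> turns at least two lists of the other triple into singletons. These two had size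
  2 and contained \<open>c\<close>; the third then misses \<open>c\<close> and has size at least
  \<open>7 - 4 = 3\<close>. So the triples can change roles: \<open>c\<close> goes to these two
  vertices, and the third is the centre of a star on \<open>u\<close>, \<open>v\<close>,
  \<open>w\<close>, where \<open>w\<close> does not have a singleton list.\<close>

lemma two_triples_meet:
  assumes p: "p u = p v" "p v = p w" "p y1 = p y2" "p y2 = p y3"
    and X: "2 \<le> card (L u)" "2 \<le> card (L v)" "2 \<le> card (L w)" "7 \<le> card (L u) + card (L v) + card (L w)"
    and Y: "2 \<le> card (L y1)" "2 \<le> card (L y2)" "2 \<le> card (L y3)" "7 \<le> card (L y1) + card (L y2) + card (L y3)"
    and c: "c \<in> L u" "c \<in> L v" "c \<notin> L w" and noY: "\<not> (c \<in> L y1 \<and> c \<in> L y2 \<and> c \<in> L y3)"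
  shows "mcol p {u, v, w, y1, y2, y3} L"
proof -
  define n where "n t = card (L t - {c})" for t
  have n: "card (L t) = n t + (if c \<in> L t then 1 else 0)" if "t \<in> {u, v, w, y1, y2, y3}" for t
    unfolding n_def by (rule card_del) (use that X(1-3) Y(1-3) in auto)
  have ne: "L y - {c} \<noteq> {}" if "0 < n y" for y
    using that unfolding n_def by (metis card.empty less_irrefl)
  have npos: "0 < n t" if "t \<in> {u, v, w, y1, y2, y3}" for t
  proof -
    have "2 \<le> card (L t)" using that X(1-3) Y(1-3) by blast
    then show ?thesis using n[OF that] by (simp split: if_splits)
  qed
  have pos: "0 < n u" "0 < n v" "0 < n w" "0 < n y1" "0 < n y2" "0 < n y3"
    using npos by simp_all
  have main: "mcol p {u, v, w, y1, y2, y3} L" if "card {y \<in> {y1, y2, y3}. n y = 1} < card (L w)"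
    using that c p pos ne unfolding n_def by (intro two_triples_pair) auto
  have cnt: "card {y \<in> {y1, y2, y3}. n y = 1}
      \<le> (if n y1 = 1 then 1 else 0) + (if n y2 = 1 then 1 else 0) + (if n y3 = 1 then 1 else 0)"
    by (rule card_three_filter)
  have cntX: "card {x \<in> {u, v, w}. n x = 1} \<le> 2"
  proof -
    have "n w \<noteq> 1" using n[of w] c(3) X(3) by auto
    then show ?thesis by (intro card_three_filter_le2) blast
  qed
  have swap: "mcol p {u, v, w, y1, y2, y3} L"
    if "{a, b, d} = {y1, y2, y3}" "c \<in> L a" "c \<in> L b" "c \<notin> L d" "3 \<le> card (L d)" for a b d
  proof -
    have "p y = p y1" if "y \<in> {y1, y2, y3}" for y using that p by auto
    moreover have "a \<in> {y1, y2, y3}" "b \<in> {y1, y2, y3}" "d \<in> {y1, y2, y3}"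
      using that(1) by blast+
    ultimately have "p a = p b" "p b = p d" by metis+
    moreover have "card {x \<in> {u, v, w}. card (L x - {c}) = 1} < card (L d)"
      using cntX that(5) unfolding n_def by linarith
    ultimately have "mcol p {a, b, d, u, v, w} L"
      using that(2-4) ne pos p by (intro two_triples_pair) auto
    then show ?thesis by (rule mcol_subset) (use that(1) in auto)
  qed
  show ?thesis
  proof (cases "card {y \<in> {y1, y2, y3}. n y = 1} < card (L w)")
    case True
    then show ?thesis by (rule main)
  next
    case False
    then have big: "2 \<le> (if n y1 = 1 then 1 else 0) + (if n y2 = 1 then 1 else 0) + (if n y3 = 1 then 1 else (0::nat))"
      using cnt X(3) by linarith
    have in_: "c \<in> L y" "card (L y) = 2" if "n y = 1" "y \<in> {y1, y2, y3}" for y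
      using n[of y] that Y(1-3) by (auto split: if_splits)
    from big consider "n y1 = 1" "n y2 = 1" | "n y1 = 1" "n y3 = 1" | "n y2 = 1" "n y3 = 1"
      by (auto split: if_splits)
    then show ?thesis
    proof cases
      case 1
      then have "c \<in> L y1" "c \<in> L y2" "card (L y1) = 2" "card (L y2) = 2" using in_ by auto
      then show ?thesis using noY Y(4) by (intro swap[of y1 y2 y3]) auto
    next
      case 2
      then have "c \<in> L y1" "c \<in> L y3" "card (L y1) = 2" "card (L y3) = 2" using in_ by auto
      then show ?thesis using noY Y(4) by (intro swap[of y1 y3 y2]) auto
    next
      case 3
      then have "c \<in> L y2" "c \<in> L y3" "card (L y2) = 2" "card (L y3) = 2" using in_ by auto
      then show ?thesis using noY Y(4) by (intro swap[of y2 y3 y1]) auto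
    qed
  qed
qed

text \<open>Colour \<open>u\<close> and \<open>v\<close> separately by \<open>c\<close> and
  \<open>d\<close>. By disjointness each of them hits at most one list of the other triple, whose
  total therefore stays at least 5, so that not all three of its lists become singletons. The list
  of \<open>w\<close> keeps three colours, enough for the centre of the star.\<close>

lemma two_triples_disjoint:
  assumes p: "p u = p v" "p v = p w" "p y1 = p y2" "p y2 = p y3"
    and X: "2 \<le> card (L u)" "2 \<le> card (L v)" "3 \<le> card (L w)"
    and Y: "2 \<le> card (L y1)" "2 \<le> card (L y2)" "2 \<le> card (L y3)" "7 \<le> card (L y1) + card (L y2) + card (L y3)"
    and disX: "L u \<inter> L v = {}" "L u \<inter> L w = {}" "L v \<inter> L w = {}"
    and disY: "L y1 \<inter> L y2 = {}" "L y1 \<inter> L y3 = {}" "L y2 \<inter> L y3 = {}"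
  shows "mcol p {u, v, w, y1, y2, y3} L"
proof -
  have dY: "\<not> (c \<in> L y1 \<and> c \<in> L y2)" "\<not> (c \<in> L y1 \<and> c \<in> L y3)" "\<not> (c \<in> L y2 \<and> c \<in> L y3)" for c
    using disY by auto
  obtain c where c: "c \<in> L u" using X(1) by fastforce
  define n where "n t = card (L t - {c})" for t
  have n: "card (L t) = n t + (if c \<in> L t then 1 else 0)" if "t \<in> {y1, y2, y3}" for t
    unfolding n_def by (rule card_del) (use that Y(1-3) in auto)
  have "card {y \<in> {y1, y2, y3}. n y = 1} \<le> 1"
  proof -
    have "c \<in> L t" if "n t = 1" "t \<in> {y1, y2, y3}" for t
    proof -
      have "2 \<le> card (L t)" using that(2) Y(1-3) by blast
      then show ?thesis using n[OF that(2)] that(1) by (simp split: if_splits)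
    qed
    then show ?thesis using dY[of c] by (intro card_three_filter_le1) blast+
  qed
  \<comment> \<open>Only one list can be a singleton after deleting \<open>c\<close>, and the two
    colours of \<open>L v\<close> leave a choice that does not empty it.\<close>
  then have "\<exists>d\<in>L v. \<forall>y\<in>{y1, y2, y3}. L y - {c} \<noteq> {d}"
    using X(2) unfolding n_def by (intro avoid_singletons) auto
  then obtain d where d: "d \<in> L v" "\<And>y. y \<in> {y1, y2, y3} \<Longrightarrow> L y - {c} \<noteq> {d}"
    by blast
  have npos: "0 < n y" if "y \<in> {y1, y2, y3}" for y
  proof -
    have "2 \<le> card (L y)" using that Y(1-3) by blast
    then show ?thesis using n[OF that] by (simp split: if_splits)
  qed
  define m where "m t = card (L t - {c} - {d})" for t
  have m: "n t = m t + (if d \<in> L t - {c} then 1 else 0)" if "t \<in> {y1, y2, y3}" for t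
    using npos[OF that] unfolding m_def n_def by (rule card_del)
  have ne: "L y - {c} - {d} \<noteq> {}" if "y \<in> {y1, y2, y3}" for y
  proof -
    have "L y - {c} \<noteq> {}" using npos[OF that] unfolding n_def by (metis card.empty less_irrefl)
    then show ?thesis using d(2)[OF that] by blast
  qed
  have "5 \<le> m y1 + m y2 + m y3"
  proof -
    have "7 \<le> n y1 + n y2 + n y3 + 1"
      using n[of y1] n[of y2] n[of y3] Y(4) dY[of c] by (simp split: if_splits)
    moreover have "n y1 + n y2 + n y3 \<le> m y1 + m y2 + m y3 + 1"
      using m[of y1] m[of y2] m[of y3] dY[of d] by (simp split: if_splits)
    ultimately show ?thesis by linarith
  qed
  then have "card {y \<in> {y1, y2, y3}. m y = 1} \<le> 2"
    by (intro card_three_filter_le2) linarith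
  moreover have "L w - {c} - {d} = L w" using c d(1) disX by blast
  ultimately have "card {y \<in> {y1, y2, y3}. card (L y - {c} - {d}) = 1} < card (L w - {c} - {d})"
    using X(3) unfolding m_def by simp
  moreover have "p a = p b" if "a \<in> {y1, y2, y3}" "b \<in> {y1, y2, y3}" for a b
    using that p by auto
  ultimately have "mcol p (insert w {y1, y2, y3}) (\<lambda>v. L v - {c} - {d})"
    using ne by (intro mcol_cone) blast+
  then have "mcol p (insert v (insert w {y1, y2, y3})) (\<lambda>v. L v - {c})"
    by (rule mcol_step[where I = "{v}"]) (use c d(1) disX in auto)
  then show ?thesis
    by (rule mcol_step[where I = "{u}"]) (use c in auto)
qed

section \<open>Size bounds for a triple\<close>

text \<open>Separate bounds for single lists, pairs and the total are kept because deleting a colour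
  affects them differently: by at most 1, 2 and 3, and the total only by 2 if no colour is common to
  the triple.\<close>

definition tri :: "('a \<Rightarrow> 'c set) \<Rightarrow> nat \<Rightarrow> nat \<Rightarrow> nat \<Rightarrow> 'a \<Rightarrow> 'a \<Rightarrow> 'a \<Rightarrow> bool" where
  "tri L d e f x y z \<longleftrightarrow> d \<le> card (L x) \<and> d \<le> card (L y) \<and> d \<le> card (L z)
     \<and> e \<le> card (L x) + card (L y) \<and> e \<le> card (L x) + card (L z) \<and> e \<le> card (L y) + card (L z)
     \<and> f \<le> card (L x) + card (L y) + card (L z)"

lemma tri_antimono: "tri L d e f x y z \<Longrightarrow> d' \<le> d \<Longrightarrow> e' \<le> e \<Longrightarrow> f' \<le> f \<Longrightarrow> tri L d' e' f' x y z"
  unfolding tri_def by auto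

lemma card_del_add: "card A \<le> card (A - {c}) + 1"
  using card_del_ge[of A c] by linarith

lemma tri_del:
  assumes "tri L (d + 1) (e + 2) (f + 3) x y z"
  shows "tri (\<lambda>v. L v - {c}) d e f x y z"
  using assms card_del_add[of "L x" c] card_del_add[of "L y" c] card_del_add[of "L z" c]
  unfolding tri_def by linarith

lemma card_del_notin: "c \<notin> A \<Longrightarrow> card (A - {c}) = card A"
  by simp

lemma tri_del_nofull:
  assumes "tri L (d + 1) (e + 2) (f + 2) x y z" "\<not> (c \<in> L x \<and> c \<in> L y \<and> c \<in> L z)"
  shows "tri (\<lambda>v. L v - {c}) d e f x y z"
proof -
  consider "c \<notin> L x" | "c \<notin> L y" | "c \<notin> L z" using assms(2) by blast
  then have "card (L x) + card (L y) + card (L z)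
      \<le> card (L x - {c}) + card (L y - {c}) + card (L z - {c}) + 2"
    using card_del_add[of "L x" c] card_del_add[of "L y" c] card_del_add[of "L z" c]
    by cases (use card_del_notin in fastforce)+
  then show ?thesis
    using assms(1) card_del_add[of "L x" c] card_del_add[of "L y" c] card_del_add[of "L z" c]
    unfolding tri_def by linarith
qed

lemma rising_append: "rising L n (as @ [w]) \<longleftrightarrow> rising L n as \<and> n + length as \<le> card (L w)"
  by (induction as arbitrary: n) auto

lemma triple_one_tri:
  assumes "p x = p y" "p y = p z" "rising L 2 as" "tri L 1 (2 + length as) (3 + 2 * length as) x y z"
  shows "mcol p ({x, y, z} \<union> set as) L"
  using assms unfolding tri_def by (intro triple_one) blast+

text \<open>One colour disposes of the whole first triple, and \<open>triple_one_tri\<close> handles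
  the other one with the single vertices.\<close>

lemma two_triples_full:
  assumes p: "p x = p y" "p y = p z" "p x' = p y'" "p y' = p z'"
    and c: "c \<in> L x" "c \<in> L y" "c \<in> L z"
    and "tri L 2 (4 + length as) (6 + 2 * length as) x' y' z'" "rising L 3 as"
  shows "mcol p ({x, y, z, x', y', z'} \<union> set as) L"
proof (rule mcol_step)
  show "mcol p ({x', y', z'} \<union> set as) (\<lambda>v. L v - {c})"
  proof (rule triple_one_tri)
    show "rising (\<lambda>v. L v - {c}) 2 as"
      using assms(9) rising_del[of L 2 as c] by (simp add: eval_nat_numeral)
    show "tri (\<lambda>v. L v - {c}) 1 (2 + length as) (3 + 2 * length as) x' y' z'"
      by (rule tri_del, rule tri_antimono[OF assms(8)]) auto
  qed (use p in auto)
  show "{x, y, z, x', y', z'} \<union> set as \<subseteq> {x', y', z'} \<union> set as \<union> {x, y, z}" by auto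
qed (use p c in auto)

text \<open>After \<open>c\<close> is used on \<open>u\<close> and \<open>v\<close>, the vertex
  \<open>w\<close> behaves as one more single vertex. Its list still has full length, so it can be
  placed at the end of the greedy order; this explains the bounds for \<open>length as + 1\<close>
  single vertices.\<close>

lemma two_triples_merge_pair:
  assumes p: "p u = p v" "p x' = p y'" "p y' = p z'"
    and c: "c \<in> L u" "c \<in> L v" "c \<notin> L w" and w: "2 + length as \<le> card (L w)"
    and "tri (\<lambda>v. L v - {c}) 1 (3 + length as) (5 + 2 * length as) x' y' z'" "rising L 3 as"
  shows "mcol p ({u, v, w, x', y', z'} \<union> set as) L"
proof (rule mcol_step)
  show "mcol p ({x', y', z'} \<union> set (as @ [w])) (\<lambda>v. L v - {c})"
  proof (rule triple_one_tri)
    show "rising (\<lambda>v. L v - {c}) 2 (as @ [w])"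
      using assms(9) rising_del[of L 2 as c] c(3) w by (simp add: eval_nat_numeral rising_append)
    show "tri (\<lambda>v. L v - {c}) 1 (2 + length (as @ [w])) (3 + 2 * length (as @ [w])) x' y' z'"
      by (rule tri_antimono[OF assms(8)]) auto
  qed (use p in auto)
  show "{u, v, w, x', y', z'} \<union> set as \<subseteq> {x', y', z'} \<union> set (as @ [w]) \<union> {u, v}" by auto
qed (use p c in auto)

text \<open>Three cases: a triple has a common colour; two lists of a triple meet, which
  \<open>two_triples_meet\<close> settles; or the lists within each triple are disjoint.\<close>

lemma two_triples0:
  assumes p: "p x = p y" "p y = p z" "p x' = p y'" "p y' = p z'"
    and X: "tri L 2 4 7 x y z" and Y: "tri L 2 4 7 x' y' z'"
  shows "mcol p {x, y, z, x', y', z'} L"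
proof -
  have X': "2 \<le> card (L x)" "2 \<le> card (L y)" "2 \<le> card (L z)" "7 \<le> card (L x) + card (L y) + card (L z)"
    and Y': "2 \<le> card (L x')" "2 \<le> card (L y')" "2 \<le> card (L z')" "7 \<le> card (L x') + card (L y') + card (L z')"
    using X Y unfolding tri_def by blast+
  have p': "p x = p z" "p x' = p z'" using p by auto
  consider (fX) c where "c \<in> L x" "c \<in> L y" "c \<in> L z"
    | (fY) c where "c \<in> L x'" "c \<in> L y'" "c \<in> L z'"
    | (no) "\<And>c. \<not> (c \<in> L x \<and> c \<in> L y \<and> c \<in> L z)" "\<And>c. \<not> (c \<in> L x' \<and> c \<in> L y' \<and> c \<in> L z')"
    by blast
  then show ?thesis
  proof cases
    case fX
    then show ?thesis using two_triples_full[of p x y z x' y' z' c L "[]"] p tri_antimono[OF Y, of 2 4 6]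
      by simp
  next
    case fY
    then have "mcol p {x', y', z', x, y, z} L"
      using two_triples_full[of p x' y' z' x y z c L "[]"] p tri_antimono[OF X, of 2 4 6] by simp
    then show ?thesis by (rule mcol_subset) blast
  next
    case no
    have disjoint: "mcol p {x, y, z, x', y', z'} L"
      if "L x \<inter> L y = {}" "L x \<inter> L z = {}" "L y \<inter> L z = {}"
        "L x' \<inter> L y' = {}" "L x' \<inter> L z' = {}" "L y' \<inter> L z' = {}"
    proof -
      \<comment> \<open>A total of 7 forces a list of size at least 3; its vertex takes the last
        place in its triple.\<close>
      consider "3 \<le> card (L z)" | "3 \<le> card (L y)" | "3 \<le> card (L x)"
        using X'(4) by linarith
      then show ?thesis
      proof cases
        case 1
        then show ?thesis using that p X' Y' by (intro two_triples_disjoint) auto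
      next
        case 2
        then have "mcol p {x, z, y, x', y', z'} L"
          using that p p' X' Y' by (intro two_triples_disjoint) auto
        then show ?thesis by (rule mcol_subset) blast
      next
        case 3
        then have "mcol p {z, y, x, x', y', z'} L"
          using that p p' X' Y' by (intro two_triples_disjoint) auto
        then show ?thesis by (rule mcol_subset) blast
      qed
    qed
    consider (xy) c where "c \<in> L x" "c \<in> L y" | (xz) c where "c \<in> L x" "c \<in> L z"
      | (yz) c where "c \<in> L y" "c \<in> L z" | (xy') c where "c \<in> L x'" "c \<in> L y'"
      | (xz') c where "c \<in> L x'" "c \<in> L z'" | (yz') c where "c \<in> L y'" "c \<in> L z'"
      | (disj) "L x \<inter> L y = {}" "L x \<inter> L z = {}" "L y \<inter> L z = {}"
          "L x' \<inter> L y' = {}" "L x' \<inter> L z' = {}" "L y' \<inter> L z' = {}"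
      by blast
    then show ?thesis
    proof cases
      case (xy c)
      then show ?thesis
        using no[of c] p X' Y' by (intro two_triples_meet[of p x y z x' y' z' L c]) auto
    next
      case (xz c)
      then have "mcol p {x, z, y, x', y', z'} L"
        using no[of c] p p' X' Y' by (intro two_triples_meet[where c = c]) auto
      then show ?thesis by (rule mcol_subset) blast
    next
      case (yz c)
      then have "mcol p {y, z, x, x', y', z'} L"
        using no[of c] p p' X' Y' by (intro two_triples_meet[where c = c]) auto
      then show ?thesis by (rule mcol_subset) blast
    next
      case (xy' c)
      then have "mcol p {x', y', z', x, y, z} L"
        using no[of c] p p' X' Y' by (intro two_triples_meet[where c = c]) auto
      then show ?thesis by (rule mcol_subset) blast
    next
      case (xz' c)
      then have "mcol p {x', z', y', x, y, z} L"
        using no[of c] p p' X' Y' by (intro two_triples_meet[where c = c]) auto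
      then show ?thesis by (rule mcol_subset) blast
    next
      case (yz' c)
      then have "mcol p {y', z', x', x, y, z} L"
        using no[of c] p p' X' Y' by (intro two_triples_meet[where c = c]) auto
      then show ?thesis by (rule mcol_subset) blast
    next
      case disj
      then show ?thesis by (rule disjoint)
    qed
  qed
qed

section \<open>Two triples with one single vertex\<close>

text \<open>The graph is a 4-cycle. A colour \<open>e\<close> of \<open>u'\<close> is used on
  \<open>w'\<close> as well if possible. Otherwise \<open>w'\<close> loses nothing to
  \<open>e\<close>, and a colour \<open>h\<close> of \<open>u\<close> either also serves
  \<open>w\<close> or leaves the list of \<open>w\<close> untouched; the rest is greedy in both
  cases.\<close>

lemma two_pairs:
  assumes p: "p u = p w" "p u' = p w'"
    and s: "2 \<le> card (L u)" "3 \<le> card (L w)" "1 \<le> card (L u')" "2 \<le> card (L w')"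
  shows "mcol p {u, w, u', w'} L"
proof -
  have "L u' \<noteq> {}" using s(3) by auto
  then obtain e where e: "e \<in> L u'" by blast
  show ?thesis
  proof (cases "e \<in> L w'")
    case True
    have "mcol p (set [u, w]) (\<lambda>v. L v - {e})"
      using card_del_ge[of "L u" e] card_del_ge[of "L w" e] s by (intro rising_mcol_empty) auto
    then show ?thesis by (rule mcol_step[where I = "{u', w'}"]) (use True e p in auto)
  next
    case False
    have u: "1 \<le> card (L u - {e})" and w: "2 \<le> card (L w - {e})"
      using card_del_ge[of "L u" e] card_del_ge[of "L w" e] s by auto
    have "L u - {e} \<noteq> {}" using u by (metis card.empty not_one_le_zero)
    then obtain h where h: "h \<in> L u - {e}" by blast
    have w': "1 \<le> card (L w' - {e} - {h})"
      using card_del_notin[OF False] card_del_ge[of "L w' - {e}" h] s(4) by linarith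
    have "mcol p (set [w', w]) (\<lambda>v. L v - {e} - {h})" if "h \<notin> L w"
      using w w' that card_del_notin[of h "L w - {e}"] by (intro rising_mcol_empty) simp
    then have "mcol p {w, w'} (\<lambda>v. L v - {e} - {h}) \<or> h \<in> L w"
      by (auto simp: insert_commute)
    moreover have "mcol p {w'} (\<lambda>v. L v - {e} - {h})"
      using w' rising_mcol_empty[of "\<lambda>v. L v - {e} - {h}" "[w']" p] by simp
    ultimately have "mcol p {u, w, w'} (\<lambda>v. L v - {e})"
    proof (elim disjE)
      assume "mcol p {w, w'} (\<lambda>v. L v - {e} - {h})"
      then show ?thesis by (rule mcol_step[where I = "{u}"]) (use h in auto)
    next
      assume "h \<in> L w" and *: "mcol p {w'} (\<lambda>v. L v - {e} - {h})"
      show ?thesis by (rule mcol_step[OF *, where I = "{u, w}"]) (use h \<open>h \<in> L w\<close> p in auto)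
    qed
    then show ?thesis by (rule mcol_step[where I = "{u'}"]) (use e in auto)
  qed
qed

text \<open>This is the extremal case left over by \<open>two_triples_single_merge\<close>: by
  \<open>HX\<close> and \<open>HY\<close>, a colour of a shortest list that recurs in its own triple
  also lies in the two shorter lists of the other triple.\<close>

lemma two_triples_single_core:
  assumes p: "p v = p u" "p u = p w" "p v' = p u'" "p u' = p w'"
    and X: "card (L v) = 2" "3 \<le> card (L u)" "4 \<le> card (L w)"
    and Y: "card (L v') = 2" "3 \<le> card (L u')" "4 \<le> card (L w')"
    and noX: "\<And>c. \<not> (c \<in> L v \<and> c \<in> L u \<and> c \<in> L w)"
    and noY: "\<And>c. \<not> (c \<in> L v' \<and> c \<in> L u' \<and> c \<in> L w')"
    and s: "L v \<subseteq> L s" and a': "a' \<in> L s" "a' \<in> L v'" "a' \<notin> L v"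
    and HX: "\<And>t. t \<in> L v \<Longrightarrow> t \<in> L u \<union> L w \<Longrightarrow> t \<in> L v' \<inter> L u'"
    and HY: "\<And>t. t \<in> L v' \<Longrightarrow> t \<in> L u' \<union> L w' \<Longrightarrow> t \<in> L v \<inter> L u"
  shows "mcol p {v, u, w, v', u', w', s} L"
proof -
  \<comment> \<open>By \<open>HY\<close>, a recurrence of \<open>a'\<close> in its triple would put
    \<open>a'\<close> into \<open>L v\<close>.\<close>
  have na': "a' \<notin> L u'" "a' \<notin> L w'" using HY[of a'] a' by auto
  show ?thesis
  proof (cases "L v \<inter> (L u \<union> L w) = {}")
    case True
    obtain a b where ab: "L v = {a, b}" "a \<noteq> b" using X(1) by (auto simp: card_2_iff)
    \<comment> \<open>The colours \<open>a'\<close>, \<open>a\<close>, \<open>b\<close> go to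
      \<open>v'\<close>, \<open>v\<close>, \<open>s\<close>. The lists of \<open>u\<close> and
      \<open>w\<close> lose at most \<open>a'\<close>, those of \<open>u'\<close> and
      \<open>w'\<close> at most \<open>a\<close> and \<open>b\<close>, which leaves the sizes
      required by \<open>two_pairs\<close>.\<close>
    let ?L = "\<lambda>v. L v - {a'} - {a} - {b}"
    have eq: "?L u = L u - {a'}" "?L w = L w - {a'}" "?L u' = L u' - {a} - {b}" "?L w' = L w' - {a} - {b}"
      using True ab na' by auto
    have "2 \<le> card (?L u)" "3 \<le> card (?L w)"
      unfolding eq using card_del_ge[of "L u" a'] card_del_ge[of "L w" a'] X by linarith+
    moreover have "1 \<le> card (?L u')" "2 \<le> card (?L w')"
      unfolding eq using card_del_ge[of "L u'" a] card_del_ge[of "L u' - {a}" b]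
        card_del_ge[of "L w'" a] card_del_ge[of "L w' - {a}" b] Y by linarith+
    ultimately have "mcol p {u, w, u', w'} ?L"
      using p by (intro two_pairs)
    then have "mcol p {s, u, w, u', w'} (\<lambda>v. L v - {a'} - {a})"
      by (rule mcol_step[where I = "{s}"]) (use ab s a' in auto)
    then have "mcol p {v, s, u, w, u', w'} (\<lambda>v. L v - {a'})"
      by (rule mcol_step[where I = "{v}"]) (use ab a' in auto)
    then show ?thesis
      by (rule mcol_step[where I = "{v'}"]) (use a' in auto)
  next
    case False
    then obtain b where b: "b \<in> L v" "b \<in> L u \<union> L w" by blast
    then have b': "b \<in> L v'" "b \<in> L u'" using HX by blast+
    then have bu: "b \<in> L u" using HY by blast
    have bw: "b \<notin> L w" "b \<notin> L w'" using noX noY b bu b' by blast+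
    obtain a where ab: "L v = {a, b}" "a \<noteq> b"
      using X(1) b(1) by (metis card_2_iff doubleton_eq_iff insertE singletonD)
    have v': "L v' = {a', b}"
      using Y(1) b'(1) a'(2,3) b(1) by (metis card_2_iff doubleton_eq_iff insertE singletonD)
    have "a \<notin> L v'" using v' ab a' by auto
    then have a: "a \<notin> L u" "a \<notin> L w" using HX[of a] ab by auto
    \<comment> \<open>Now \<open>b\<close> goes to \<open>v\<close> and \<open>u\<close>,
      \<open>a'\<close> to \<open>v'\<close>, and \<open>a\<close> to \<open>s\<close>. The
      remaining lists of \<open>u'\<close>, \<open>w\<close>, \<open>w'\<close> have at least 1, 2,
      3 colours, because \<open>a\<close> is missing from \<open>L w\<close> and \<open>b\<close>
      from \<open>L w\<close> and \<open>L w'\<close>.\<close>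
    let ?L = "\<lambda>v. L v - {b} - {a'} - {a}"
    have eq: "?L w = L w - {a'}" "?L u' = L u' - {b} - {a}" "?L w' = L w' - {a}"
      using a na' bw by auto
    have "1 \<le> card (?L u')" "2 \<le> card (?L w)" "3 \<le> card (?L w')"
      unfolding eq using card_del_ge[of "L w" a'] card_del_ge[of "L u'" b]
        card_del_ge[of "L u' - {b}" a] card_del_ge[of "L w'" a] X Y by linarith+
    then have "mcol p (set [u', w, w']) ?L"
      by (intro rising_mcol_empty) simp
    then have "mcol p {s, u', w, w'} (\<lambda>v. L v - {b} - {a'})"
      by (rule mcol_step[where I = "{s}"]) (use ab s a' in auto)
    then have "mcol p {v', s, u', w, w'} (\<lambda>v. L v - {b})"
      by (rule mcol_step[where I = "{v'}"]) (use ab v' a' in auto)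
    then show ?thesis
      by (rule mcol_step[where I = "{v, u}"]) (use b bu p in auto)
  qed
qed

text \<open>Use \<open>t\<close> on \<open>v\<close> and on whichever of \<open>u\<close>,
  \<open>w\<close> has it. Since \<open>t\<close> is missing from \<open>L v'\<close> or
  \<open>L u'\<close>, the critical pair sum on the other side drops only from 5 to 4, so
  \<open>two_triples_merge_pair\<close> applies with the one single vertex \<open>s\<close>.\<close>

lemma two_triples_single_merge:
  assumes p: "p v = p u" "p u = p w" "p v' = p u'" "p u' = p w'"
    and X: "card (L v) = 2" "3 \<le> card (L u)" "4 \<le> card (L w)"
    and Y: "card (L v') = 2" "3 \<le> card (L u')" "4 \<le> card (L w')"
    and noX: "\<And>c. \<not> (c \<in> L v \<and> c \<in> L u \<and> c \<in> L w)"
    and noY: "\<And>c. \<not> (c \<in> L v' \<and> c \<in> L u' \<and> c \<in> L w')"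
    and s: "3 \<le> card (L s)"
    and t: "t \<in> L v" "t \<in> L u \<union> L w" "t \<notin> L v' \<inter> L u'"
  shows "mcol p {v, u, w, v', u', w', s} L"
proof -
  have "4 \<le> card (L v' - {t}) + card (L u' - {t})"
  proof (cases "t \<in> L v'")
    case True
    then have "t \<notin> L u'" using t(3) by blast
    then show ?thesis using card_del_notin[of t "L u'"] card_del_ge[of "L v'" t] Y by linarith
  next
    case False
    then show ?thesis using card_del_notin[of t "L v'"] card_del_ge[of "L u'" t] Y by linarith
  qed
  then have tri: "tri (\<lambda>v. L v - {t}) 1 (3 + length [s]) (5 + 2 * length [s]) v' u' w'"
    using card_del_ge[of "L v'" t] card_del_ge[of "L u'" t] card_del_ge[of "L w'" t] Y
    unfolding tri_def by auto
  have rs: "rising L 3 [s]" using s by simp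
  show ?thesis
  proof (cases "t \<in> L u")
    case True
    then have "mcol p ({v, u, w, v', u', w'} \<union> set [s]) L"
      using p t(1) noX[of t] X by (intro two_triples_merge_pair[OF _ _ _ _ _ _ _ tri rs]) auto
    then show ?thesis by (rule mcol_subset) auto
  next
    case False
    then have "mcol p ({v, w, u, v', u', w'} \<union> set [s]) L"
      using p t(1,2) X by (intro two_triples_merge_pair[OF _ _ _ _ _ _ _ tri rs]) auto
    then show ?thesis by (rule mcol_subset) auto
  qed
qed

text \<open>Next to a list of size 2 the pair bound 5 makes the others at least 3, and the total 9
  makes one of them at least 4. Hence a triple has at most one list of size 2.\<close>

lemma tri_two_elim:
  assumes "tri L 2 5 9 x y z"
  shows "(\<forall>t\<in>{x, y, z}. card (L t) \<noteq> 2) \<or>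
    (\<exists>v u w. {v, u, w} = {x, y, z} \<and> card (L v) = 2 \<and> 3 \<le> card (L u) \<and> 4 \<le> card (L w))"
proof (cases "\<forall>t\<in>{x, y, z}. card (L t) \<noteq> 2")
  case False
  have *: "3 \<le> card (L u) \<and> 4 \<le> card (L w) \<or> 3 \<le> card (L w) \<and> 4 \<le> card (L u)"
    if "card (L v) = 2" "{v, u, w} = {x, y, z}" "tri L 2 5 9 v u w" for v u w
    using that unfolding tri_def by linarith
  have t: "tri L 2 5 9 x y z" "tri L 2 5 9 y x z" "tri L 2 5 9 z x y"
    using assms unfolding tri_def by linarith+
  have e: "{x, y, z} = {x, y, z}" "{x, z, y} = {x, y, z}" "{y, x, z} = {x, y, z}"
    "{y, z, x} = {x, y, z}" "{z, x, y} = {x, y, z}" "{z, y, x} = {x, y, z}" by auto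
  from False consider "card (L x) = 2" | "card (L y) = 2" | "card (L z) = 2" by blast
  then show ?thesis
    by cases (use * t e in metis)+
qed simp

text \<open>Without a common colour in a triple, try to give \<open>s\<close> a colour outside all
  lists of size 2. If there is none, \<open>L s\<close> is covered by such lists, which pins down
  the sizes in both triples and leaves the merging and the extremal case.\<close>

lemma two_triples_single:
  assumes p: "p x = p y" "p y = p z" "p x' = p y'" "p y' = p z'"
    and X: "tri L 2 5 9 x y z" and Y: "tri L 2 5 9 x' y' z'" and s: "3 \<le> card (L s)"
  shows "mcol p {x, y, z, x', y', z', s} L"
proof -
  have pX: "p a = p b" if "a \<in> {x, y, z}" "b \<in> {x, y, z}" for a b
    using that p by auto
  have pY: "p a = p b" if "a \<in> {x', y', z'}" "b \<in> {x', y', z'}" for a b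
    using that p by auto
  consider (fX) c where "c \<in> L x" "c \<in> L y" "c \<in> L z"
    | (fY) c where "c \<in> L x'" "c \<in> L y'" "c \<in> L z'"
    | (no) "\<And>c. \<not> (c \<in> L x \<and> c \<in> L y \<and> c \<in> L z)" "\<And>c. \<not> (c \<in> L x' \<and> c \<in> L y' \<and> c \<in> L z')"
    by blast
  then show ?thesis
  proof cases
    case fX
    have "mcol p ({x, y, z, x', y', z'} \<union> set [s]) L"
      by (rule two_triples_full[where p = p, OF p fX]) (use s tri_antimono[OF Y, of 2 5 8] in auto)
    then show ?thesis by (rule mcol_subset) auto
  next
    case fY
    have "mcol p ({x', y', z', x, y, z} \<union> set [s]) L"
      by (rule two_triples_full[where p = p, OF p(3,4,1,2) fY]) (use s tri_antimono[OF X, of 2 5 8] in auto)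
    then show ?thesis by (rule mcol_subset) auto
  next
    case no
    \<comment> \<open>Every list keeps two colours, so the pair bound 4 is automatic, and the total
      drops by at most 2.\<close>
    have del: "tri (\<lambda>v. L v - {c}) 2 4 7 a b d"
      if "tri L 2 5 9 a b d" "\<not> (c \<in> L a \<and> c \<in> L b \<and> c \<in> L d)"
        "\<And>t. t \<in> {a, b, d} \<Longrightarrow> c \<in> L t \<Longrightarrow> card (L t) \<noteq> 2" for a b d c
    proof -
      have "2 \<le> card (L t - {c})" if "t \<in> {a, b, d}" for t
      proof (cases "c \<in> L t")
        case True
        then have "card (L t) \<noteq> 2" using \<open>\<And>t. t \<in> {a, b, d} \<Longrightarrow> c \<in> L t \<Longrightarrow> card (L t) \<noteq> 2\<close> that by blast
        moreover have "2 \<le> card (L t)" using \<open>tri L 2 5 9 a b d\<close> that unfolding tri_def by auto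
        ultimately show ?thesis using card_del_ge[of "L t" c] by linarith
      next
        case False
        then show ?thesis using \<open>tri L 2 5 9 a b d\<close> that unfolding tri_def by auto
      qed
      then have "2 \<le> card (L a - {c})" "2 \<le> card (L b - {c})" "2 \<le> card (L d - {c})" by blast+
      moreover have "tri (\<lambda>v. L v - {c}) 1 3 7 a b d"
        by (rule tri_del_nofull) (use that(1,2) in \<open>simp_all add: eval_nat_numeral\<close>)
      ultimately show ?thesis unfolding tri_def by linarith
    qed
    show ?thesis
    proof (cases "\<exists>c\<in>L s. \<forall>t\<in>{x, y, z} \<union> {x', y', z'}. c \<in> L t \<longrightarrow> card (L t) \<noteq> 2")
      case True
      then obtain c where c: "c \<in> L s"
        "\<And>t. t \<in> {x, y, z} \<union> {x', y', z'} \<Longrightarrow> c \<in> L t \<Longrightarrow> card (L t) \<noteq> 2" by blast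
      have "mcol p {x, y, z, x', y', z'} (\<lambda>v. L v - {c})"
        by (rule two_triples0[where p = p, OF p]) (use del[OF X no(1)[of c]] del[OF Y no(2)[of c]] c(2) in blast)+
      then show ?thesis by (rule mcol_step[where I = "{s}"]) (use c in auto)
    next
      case False
      then have cover: "\<exists>t\<in>{x, y, z} \<union> {x', y', z'}. c \<in> L t \<and> card (L t) = 2" if "c \<in> L s" for c
        using that by blast
      have short: "\<not> L s \<subseteq> L t" if "card (L t) = 2" for t
        using s that card_mono[of "L t" "L s"] by (metis card.infinite le_trans not_less_eq_eq
            numeral_2_eq_2 numeral_3_eq_3 order_refl zero_neq_numeral)
      have only: "t = v" if "{v, u, w} = A" "3 \<le> card (L u)" "4 \<le> card (L w)" "t \<in> A" "card (L t) = 2"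
        for t v u w A using that by auto
      \<comment> \<open>If this triple had no list of size 2, the at least three colours of
        \<open>L s\<close> would all lie in a single list of size 2, or there would be none.\<close>
      have ex1: "\<exists>v u w. {v, u, w} = {x, y, z} \<and> card (L v) = 2 \<and> 3 \<le> card (L u) \<and> 4 \<le> card (L w)"
      proof (rule ccontr)
        assume "\<not> ?thesis"
        then have none: "\<forall>t\<in>{x, y, z}. card (L t) \<noteq> 2" using tri_two_elim[OF X] by blast
        from tri_two_elim[OF Y] show False
        proof (elim disjE exE conjE)
          assume "\<forall>t\<in>{x', y', z'}. card (L t) \<noteq> 2"
          then have "L s = {}" using cover none by blast
          then show False using s by simp
        next
          fix v u w assume *: "{v, u, w} = {x', y', z'}" "card (L v) = 2" "3 \<le> card (L u)" "4 \<le> card (L w)"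
          have "L s \<subseteq> L v" using cover none only[OF *(1,3,4)] by blast
          then show False using short[OF *(2)] by blast
        qed
      qed
      have ex2: "\<exists>v u w. {v, u, w} = {x', y', z'} \<and> card (L v) = 2 \<and> 3 \<le> card (L u) \<and> 4 \<le> card (L w)"
      proof (rule ccontr)
        assume "\<not> ?thesis"
        then have none: "\<forall>t\<in>{x', y', z'}. card (L t) \<noteq> 2" using tri_two_elim[OF Y] by blast
        obtain v u w where *: "{v, u, w} = {x, y, z}" "card (L v) = 2" "3 \<le> card (L u)" "4 \<le> card (L w)"
          using ex1 by blast
        have "L s \<subseteq> L v" using cover none only[OF *(1,3,4)] by blast
        then show False using short[OF *(2)] by blast
      qed
      obtain v u w where v: "{v, u, w} = {x, y, z}" "card (L v) = 2" "3 \<le> card (L u)" "4 \<le> card (L w)"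
        using ex1 by blast
      obtain v' u' w' where v': "{v', u', w'} = {x', y', z'}" "card (L v') = 2" "3 \<le> card (L u')" "4 \<le> card (L w')"
        using ex2 by blast
      have m: "v \<in> {x, y, z}" "u \<in> {x, y, z}" "w \<in> {x, y, z}" using v(1) by blast+
      have m': "v' \<in> {x', y', z'}" "u' \<in> {x', y', z'}" "w' \<in> {x', y', z'}" using v'(1) by blast+
      note pp = pX[OF m(1,2)] pX[OF m(2,3)] pY[OF m'(1,2)] pY[OF m'(2,3)]
      have noX: "\<not> (c \<in> L v \<and> c \<in> L u \<and> c \<in> L w)" for c
      proof
        assume "c \<in> L v \<and> c \<in> L u \<and> c \<in> L w"
        then have "\<forall>t\<in>{v, u, w}. c \<in> L t" by blast
        then show False unfolding v(1) using no(1)[of c] by blast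
      qed
      have noY: "\<not> (c \<in> L v' \<and> c \<in> L u' \<and> c \<in> L w')" for c
      proof
        assume "c \<in> L v' \<and> c \<in> L u' \<and> c \<in> L w'"
        then have "\<forall>t\<in>{v', u', w'}. c \<in> L t" by blast
        then show False unfolding v'(1) using no(2)[of c] by blast
      qed
      have sub: "L s \<subseteq> L v \<union> L v'"
        using cover only[OF v(1,3,4)] only[OF v'(1,3,4)] by blast
      have sets: "{x, y, z, x', y', z', s} \<subseteq> {v, u, w, v', u', w', s}"
      proof -
        have "{x, y, z} \<union> {x', y', z'} \<union> {s} \<subseteq> {v, u, w} \<union> {v', u', w'} \<union> {s}"
          unfolding v(1) v'(1) by simp
        then show ?thesis by blast
      qed
      show ?thesis
      \<comment> \<open>If a recurring colour of \<open>L v\<close> or \<open>L v'\<close> can be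
        used for merging, merge; otherwise the negations are exactly \<open>HX\<close> and
        \<open>HY\<close> of the extremal case.\<close>
      proof (cases "(\<exists>t. t \<in> L v \<and> t \<in> L u \<union> L w \<and> t \<notin> L v' \<inter> L u') \<or>
          (\<exists>t. t \<in> L v' \<and> t \<in> L u' \<union> L w' \<and> t \<notin> L v \<inter> L u)")
        case True
        then have "mcol p {v, u, w, v', u', w', s} L"
        proof (elim disjE exE conjE)
          fix t assume "t \<in> L v" "t \<in> L u \<union> L w" "t \<notin> L v' \<inter> L u'"
          then show ?thesis
            by (rule two_triples_single_merge[where p = p, OF pp v(2-4) v'(2-4) noX noY s])
        next
          fix t assume "t \<in> L v'" "t \<in> L u' \<union> L w'" "t \<notin> L v \<inter> L u"
          then have "mcol p {v', u', w', v, u, w, s} L"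
            by (rule two_triples_single_merge[where p = p, OF pp(3,4,1,2) v'(2-4) v(2-4) noY noX s])
          then show ?thesis by (rule mcol_subset) blast
        qed
        then show ?thesis using sets by (rule mcol_subset)
      next
        case False
        have fin: "finite (L v)" "finite (L v')" "finite (L s)"
          using v(2) v'(2) s by (auto intro: card_ge_0_finite)
        \<comment> \<open>At least three colours inside the union of two 2-element lists include one
          of these lists entirely, together with a colour from outside it.\<close>
        have "L v \<subseteq> L s \<and> (\<exists>a\<in>L s. a \<in> L v' \<and> a \<notin> L v) \<or> L v' \<subseteq> L s \<and> (\<exists>a\<in>L s. a \<in> L v \<and> a \<notin> L v')"
        proof (cases "L v \<subseteq> L s")
          case True
          then show ?thesis using short[OF v(2)] sub by blast
        next
          case False
          then have "card (L s \<inter> L v) < card (L v)"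
            using fin by (intro psubset_card_mono) auto
          moreover have "card (L s) = card (L s \<inter> L v) + card (L s - L v)"
            using fin by (subst card_Un_disjoint[symmetric]) (auto intro: arg_cong[where f = card])
          ultimately have "card (L v') \<le> card (L s - L v)" using v(2) v'(2) s by linarith
          then have "L s - L v = L v'"
            using sub fin by (intro card_seteq) auto
          then show ?thesis using short[OF v'(2)] by blast
        qed
        then have "mcol p {v, u, w, v', u', w', s} L"
        proof (elim disjE conjE bexE)
          fix a assume "L v \<subseteq> L s" "a \<in> L s" "a \<in> L v'" "a \<notin> L v"
          then show ?thesis using False
            by (intro two_triples_single_core[where p = p, OF pp v(2-4) v'(2-4) noX noY]) blast+
        next
          fix a assume "L v' \<subseteq> L s" "a \<in> L s" "a \<in> L v" "a \<notin> L v'"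
          then have "mcol p {v', u', w', v, u, w, s} L" using False
            by (intro two_triples_single_core[where p = p, OF pp(3,4,1,2) v'(2-4) v(2-4) noY noX]) blast+
          then show ?thesis by (rule mcol_subset) blast
        qed
        then show ?thesis using sets by (rule mcol_subset)
      qed
    qed
  qed
qed

section \<open>Two triples with two or three single vertices\<close>

text \<open>
  The only obstruction to deleting \<open>c\<close> from the lists while keeping the bounds needed for
  \<open>two_triples_single\<close>.
\<close>
definition tight_pair :: "('a \<Rightarrow> 'c set) \<Rightarrow> 'c \<Rightarrow> 'a set \<Rightarrow> 'a \<Rightarrow> 'a \<Rightarrow> 'a \<Rightarrow> bool" where
  "tight_pair L c T u v w \<longleftrightarrow>
     {u, v, w} = T \<and> c \<in> L u \<and> c \<in> L v \<and> c \<notin> L w \<and> 5 \<le> card (L w)"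

text \<open>Only a pair with \<open>c\<close> in both lists loses 2. Its third list misses
  \<open>c\<close> and, as the pair is not tight, has at most 4 colours; the total 11 then gives the
  pair at least 7, so 5 remain.\<close>

lemma tri_del_no_tight_pair:
  assumes "tri L 3 6 11 x y z" "\<not> (c \<in> L x \<and> c \<in> L y \<and> c \<in> L z)"
    and "\<nexists>u v w. tight_pair L c {x, y, z} u v w"
  shows "tri (\<lambda>v. L v - {c}) 2 5 9 x y z"
proof -
  have pair: "5 \<le> card (L a - {c}) + card (L b - {c})"
    if T: "{a, b, d} = {x, y, z}" "tri L 3 6 11 a b d" for a b d
  proof (cases "c \<in> L a \<and> c \<in> L b")
    case True
    have "c \<notin> L d"
    proof
      assume "c \<in> L d"
      then have "\<forall>t\<in>{a, b, d}. c \<in> L t" using True by blast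
      then show False unfolding T(1) using assms(2) by blast
    qed
    then have "\<not> 5 \<le> card (L d)"
      using True T(1) assms(3) unfolding tight_pair_def by blast
    then show ?thesis
      using T(2) card_del_add[of "L a" c] card_del_add[of "L b" c] unfolding tri_def by linarith
  next
    case False
    then consider "c \<notin> L a" | "c \<notin> L b" by blast
    then show ?thesis
      using T(2) card_del_add[of "L a" c] card_del_add[of "L b" c] unfolding tri_def
      by cases (use card_del_notin in fastforce)+
  qed
  have "tri L 3 6 11 x z y" "tri L 3 6 11 y z x" using assms(1) unfolding tri_def by linarith+
  then have "5 \<le> card (L x - {c}) + card (L y - {c})" "5 \<le> card (L x - {c}) + card (L z - {c})"
      "5 \<le> card (L y - {c}) + card (L z - {c})"
    using pair[of x y z] pair[of x z y] pair[of y z x] assms(1) by blast+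
  moreover have "tri (\<lambda>v. L v - {c}) 2 4 9 x y z"
    by (rule tri_del_nofull) (use assms(1,2) in simp_all)
  ultimately show ?thesis unfolding tri_def by linarith
qed

text \<open>Use \<open>c\<close> on the tight pair; the five colours of the third vertex suffice to
  place it after \<open>s\<close> and \<open>t\<close>.\<close>

lemma two_triples_two_tight:
  assumes X: "tight_pair L c {x, y, z} u v w" and Y: "tri (\<lambda>v. L v - {c}) 2 5 9 x' y' z'"
    and p: "p x = p y" "p y = p z" "p x' = p y'" "p y' = p z'"
    and "3 \<le> card (L s)" "4 \<le> card (L t)"
  shows "mcol p {x, y, z, x', y', z', s, t} L"
proof -
  have e: "{u, v, w} = {x, y, z}" and uvw: "c \<in> L u" "c \<in> L v" "c \<notin> L w" "5 \<le> card (L w)"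
    using X unfolding tight_pair_def by blast+
  have "u \<in> {x, y, z}" "v \<in> {x, y, z}" using e by blast+
  then have "p u = p v" using p by auto
  then have "mcol p ({u, v, w, x', y', z'} \<union> set [s, t]) L"
    using uvw p assms(7,8) tri_antimono[OF Y, of 1 5 9]
    by (intro two_triples_merge_pair[where c = c]) auto
  moreover have "{x, y, z} \<union> {x', y', z', s, t} \<subseteq> {u, v, w, x', y', z'} \<union> set [s, t]"
    unfolding e[symmetric] by auto
  ultimately show ?thesis using mcol_subset by (metis Un_insert_left sup_bot_left)
qed

text \<open>A colour of \<open>s\<close> that is tight in neither triple goes to \<open>s\<close>;
  one that is tight in exactly one triple goes to its tight pair. If two colours of \<open>s\<close>
  are tight in different triples, both pairs are coloured at once.\<close>

lemma two_triples_two: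
  assumes p: "p x = p y" "p y = p z" "p x' = p y'" "p y' = p z'"
    and X: "tri L 3 6 11 x y z" and Y: "tri L 3 6 11 x' y' z'"
    and st: "3 \<le> card (L s)" "4 \<le> card (L t)"
  shows "mcol p {x, y, z, x', y', z', s, t} L"
proof -
  consider (fX) c where "c \<in> L x" "c \<in> L y" "c \<in> L z"
    | (fY) c where "c \<in> L x'" "c \<in> L y'" "c \<in> L z'"
    | (no) "\<And>c. \<not> (c \<in> L x \<and> c \<in> L y \<and> c \<in> L z)" "\<And>c. \<not> (c \<in> L x' \<and> c \<in> L y' \<and> c \<in> L z')"
    by blast
  then show ?thesis
  proof cases
    case fX
    have "mcol p ({x, y, z, x', y', z'} \<union> set [s, t]) L"
      by (rule two_triples_full[where p = p, OF p fX]) (use st tri_antimono[OF Y, of 2 6 10] in auto)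
    then show ?thesis by (rule mcol_subset) auto
  next
    case fY
    have "mcol p ({x', y', z', x, y, z} \<union> set [s, t]) L"
      by (rule two_triples_full[where p = p, OF p(3,4,1,2) fY])
        (use st tri_antimono[OF X, of 2 6 10] in auto)
    then show ?thesis by (rule mcol_subset) auto
  next
    case no
    let ?bX = "\<lambda>c. \<exists>u v w. tight_pair L c {x, y, z} u v w"
    let ?bY = "\<lambda>c. \<exists>u v w. tight_pair L c {x', y', z'} u v w"
    have gX: "tri (\<lambda>v. L v - {c}) 2 5 9 x y z" if "\<not> ?bX c" for c
      by (rule tri_del_no_tight_pair[OF X no(1)[of c] that])
    have gY: "tri (\<lambda>v. L v - {c}) 2 5 9 x' y' z'" if "\<not> ?bY c" for c
      by (rule tri_del_no_tight_pair[OF Y no(2)[of c] that])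
    have one: ?thesis if c: "c \<in> L s" and nb: "\<not> (?bX c \<and> ?bY c)" for c
    proof -
      consider (neither) "\<not> ?bX c" "\<not> ?bY c" | (X) "?bX c" "\<not> ?bY c" | (Y) "\<not> ?bX c" "?bY c"
        using nb by blast
      then show ?thesis
      proof cases
        case neither
        have "mcol p {x, y, z, x', y', z', t} (\<lambda>v. L v - {c})"
          using gX[OF neither(1)] gY[OF neither(2)] card_del_ge[of "L t" c] st
          by (intro two_triples_single p) auto
        then show ?thesis by (rule mcol_step[where I = "{s}"]) (use c in auto)
      next
        case X
        then obtain u v w where "tight_pair L c {x, y, z} u v w" by blast
        then show ?thesis by (rule two_triples_two_tight[OF _ gY[OF X(2)] p st])
      next
        case Y
        then obtain u v w where "tight_pair L c {x', y', z'} u v w" by blast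
        then have "mcol p {x', y', z', x, y, z, s, t} L"
          by (rule two_triples_two_tight[where p = p, OF _ gX[OF Y(1)] p(3,4,1,2) st])
        then show ?thesis by (rule mcol_subset) blast
      qed
    qed
    obtain c d where cd: "c \<in> L s" "d \<in> L s" "c \<noteq> d"
      using st(1) two_elements[of "L s"] by auto
    show ?thesis
    \<comment> \<open>If this fails, \<open>c\<close> or \<open>d\<close> is not tight in both
      triples, so \<open>one\<close> applies to it.\<close>
    proof (cases "?bX c \<and> ?bY d")
      case False
      then show ?thesis using one cd by blast
    next
      case True
      then obtain u v w u' v' w' where *: "tight_pair L c {x, y, z} u v w"
          "tight_pair L d {x', y', z'} u' v' w'" by blast
      have e: "{u, v, w} = {x, y, z}" "{u', v', w'} = {x', y', z'}"
        and c: "c \<in> L u" "c \<in> L v" "c \<notin> L w" "5 \<le> card (L w)"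
        and d: "d \<in> L u'" "d \<in> L v'" "d \<notin> L w'" "5 \<le> card (L w')"
        using * unfolding tight_pair_def by blast+
      have m: "u \<in> {x, y, z}" "v \<in> {x, y, z}" "u' \<in> {x', y', z'}" "v' \<in> {x', y', z'}"
        using e by blast+
      have puv: "p u = p v" using m(1,2) p by auto
      have puv': "p u' = p v'" using m(3,4) p by auto
      \<comment> \<open>With both tight pairs coloured, \<open>s\<close>, \<open>t\<close>,
        \<open>w\<close>, \<open>w'\<close> remain, with at least 1, 2, 3, 4 colours in this order;
        \<open>w'\<close> cannot lose \<open>d\<close>.\<close>
      have "1 \<le> card (L s - {c} - {d})" "2 \<le> card (L t - {c} - {d})"
        using st card_del_ge[of "L s" c] card_del_ge[of "L s - {c}" d]
          card_del_ge[of "L t" c] card_del_ge[of "L t - {c}" d] by linarith+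
      moreover have "3 \<le> card (L w - {c} - {d})" "4 \<le> card (L w' - {c} - {d})"
        using c(4) d(3,4) card_del_ge[of "L w" c] card_del_ge[of "L w - {c}" d]
          card_del_ge[of "L w'" c] card_del_notin[of d "L w' - {c}"] by (linarith, simp)
      ultimately have "mcol p (set [s, t, w, w']) (\<lambda>v. L v - {c} - {d})"
        by (intro rising_mcol_empty) simp
      then have "mcol p (set [s, t, w, w'] \<union> {u', v'}) (\<lambda>v. L v - {c})"
        by (rule mcol_step[where I = "{u', v'}"]) (use d cd puv' in auto)
      then have "mcol p (set [s, t, w, w'] \<union> {u', v'} \<union> {u, v}) L"
        by (rule mcol_step[where I = "{u, v}"]) (use c puv in auto)
      moreover have "{u, v, w} \<union> {u', v', w'} \<union> {s, t} \<subseteq> set [s, t, w, w'] \<union> {u', v'} \<union> {u, v}"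
        by auto
      then have "{x, y, z} \<union> {x', y', z'} \<union> {s, t} \<subseteq> set [s, t, w, w'] \<union> {u', v'} \<union> {u, v}"
        unfolding e .
      ultimately have "mcol p ({x, y, z} \<union> {x', y', z'} \<union> {s, t}) L"
        by (rule mcol_subset)
      then show ?thesis by (rule mcol_subset) blast
    qed
  qed
qed

text \<open>The bounds 4, 8, 13 are those of a triple with list sizes 4, 4, 5. Without a common
  colour in a triple, any colour may be spent on \<open>r\<close>, which lowers them to 3, 6,
  11.\<close>

lemma two_triples_three:
  assumes p: "p x = p y" "p y = p z" "p x' = p y'" "p y' = p z'"
    and X: "tri L 4 8 13 x y z" and Y: "tri L 4 8 13 x' y' z'"
    and st: "4 \<le> card (L r)" "4 \<le> card (L s)" "5 \<le> card (L t)"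
  shows "mcol p {x, y, z, x', y', z', r, s, t} L"
proof -
  consider (fX) c where "c \<in> L x" "c \<in> L y" "c \<in> L z"
    | (fY) c where "c \<in> L x'" "c \<in> L y'" "c \<in> L z'"
    | (no) "\<And>c. \<not> (c \<in> L x \<and> c \<in> L y \<and> c \<in> L z)" "\<And>c. \<not> (c \<in> L x' \<and> c \<in> L y' \<and> c \<in> L z')"
    by blast
  then show ?thesis
  proof cases
    case fX
    have "mcol p ({x, y, z, x', y', z'} \<union> set [r, s, t]) L"
      by (rule two_triples_full[where p = p, OF p fX]) (use st tri_antimono[OF Y, of 2 7 12] in auto)
    then show ?thesis by (rule mcol_subset) auto
  next
    case fY
    have "mcol p ({x', y', z', x, y, z} \<union> set [r, s, t]) L"
      by (rule two_triples_full[where p = p, OF p(3,4,1,2) fY])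
        (use st tri_antimono[OF X, of 2 7 12] in auto)
    then show ?thesis by (rule mcol_subset) auto
  next
    case no
    obtain c where c: "c \<in> L r" using st(1) by fastforce
    have "tri (\<lambda>v. L v - {c}) 3 6 11 x y z" "tri (\<lambda>v. L v - {c}) 3 6 11 x' y' z'"
      by (rule tri_del_nofull; use X Y no in simp)+
    then have "mcol p {x, y, z, x', y', z', s, t} (\<lambda>v. L v - {c})"
      using card_del_ge[of "L s" c] card_del_ge[of "L t" c] st
      by (intro two_triples_two p) auto
    then show ?thesis by (rule mcol_step[where I = "{r}"]) (use c in auto)
  qed
qed

section \<open>Hall's theorem and the reduction to few colours\<close>

text \<open>The Halmos-Vaughan induction: a nonempty proper subset with equality in Hall's condition
  splits the problem into two; if there is none, an arbitrary colour can be spent on one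
  vertex.\<close>

lemma hall_marriage:
  fixes L :: "'a \<Rightarrow> 'c set"
  assumes "finite V" and "\<And>v. v \<in> V \<Longrightarrow> finite (L v)"
    and "\<And>X. X \<subseteq> V \<Longrightarrow> card X \<le> card (\<Union>(L ` X))"
  shows "\<exists>c. inj_on c V \<and> (\<forall>v\<in>V. c v \<in> L v)"
  using assms
proof (induction V arbitrary: L rule: finite_psubset_induct)
  case (psubset V)
  show ?case
  proof (cases "V = {}")
    case False
    then obtain v where v: "v \<in> V" by blast
    show ?thesis
    proof (cases "\<exists>X. X \<noteq> {} \<and> X \<subset> V \<and> card (\<Union>(L ` X)) = card X")
      case True
      then obtain X where X: "X \<noteq> {}" "X \<subset> V" "card (\<Union>(L ` X)) = card X" by blast
      let ?N = "\<Union>(L ` X)"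
      have fX: "finite X" using X(2) psubset.hyps(1) by (meson finite_subset psubsetE)
      have fN: "finite ?N" using fX X(2) psubset.prems(1) by blast
      have sub: "Y \<subseteq> V" if "Y \<subseteq> X" for Y using that X(2) by blast
      obtain c where c: "inj_on c X" "\<forall>v\<in>X. c v \<in> L v"
        using psubset.IH[OF X(2), of L] psubset.prems X(2) sub by (metis psubsetD)
      have "\<exists>d. inj_on d (V - X) \<and> (\<forall>v\<in>V - X. d v \<in> L v - ?N)"
      proof (rule psubset.IH)
        show "V - X \<subset> V" using X by blast
        show "finite (L v - ?N)" if "v \<in> V - X" for v using psubset.prems(1) that by blast
        show "card Y \<le> card (\<Union>v\<in>Y. L v - ?N)" if "Y \<subseteq> V - X" for Y
        proof -
          have fY: "finite Y" using that psubset.hyps(1) by (meson Diff_subset finite_subset)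
          have "card X + card Y = card (X \<union> Y)"
            using that fX fY by (intro card_Un_disjoint[symmetric]) auto
          also have "\<dots> \<le> card (\<Union>(L ` (X \<union> Y)))"
            using that X(2) by (intro psubset.prems(2)) blast
          also have "\<Union>(L ` (X \<union> Y)) = ?N \<union> (\<Union>v\<in>Y. L v - ?N)" by auto
          also have "card \<dots> \<le> card ?N + card (\<Union>v\<in>Y. L v - ?N)" by (rule card_Un_le)
          finally show ?thesis using X(3) by linarith
        qed
      qed
      then obtain d where d: "inj_on d (V - X)" "\<And>v. v \<in> V - X \<Longrightarrow> d v \<in> L v - ?N" by blast
      let ?e = "\<lambda>v. if v \<in> X then c v else d v"
      have cross: "c a \<noteq> d b" if "a \<in> X" "b \<in> V - X" for a b
        using c(2) d(2)[OF that(2)] that(1) by auto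
      have "inj_on ?e V"
      proof (rule inj_onI)
        fix a b assume "a \<in> V" "b \<in> V" "?e a = ?e b"
        then show "a = b"
          using cross[of a b] cross[of b a] inj_onD[OF c(1), of a b] inj_onD[OF d(1), of a b]
          by (auto split: if_splits)
      qed
      moreover have "\<forall>v\<in>V. ?e v \<in> L v" using c(2) d(2) by auto
      ultimately show ?thesis by (intro exI[of _ ?e]) blast
    next
      case slack: False
      have "card {v} \<le> card (\<Union>(L ` {v}))" by (rule psubset.prems(2)) (use v in blast)
      then have "L v \<noteq> {}" by auto
      then obtain a where a: "a \<in> L v" by blast
      have "\<exists>d. inj_on d (V - {v}) \<and> (\<forall>u\<in>V - {v}. d u \<in> L u - {a})"
      proof (rule psubset.IH)
        show "V - {v} \<subset> V" using v by blast
        show "finite (L u - {a})" if "u \<in> V - {v}" for u using psubset.prems(1) that by blast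
        show "card Y \<le> card (\<Union>u\<in>Y. L u - {a})" if "Y \<subseteq> V - {v}" for Y
        proof (cases "Y = {}")
          case False
          have "Y \<subset> V" using that v by blast
          then have "card Y < card (\<Union>(L ` Y))"
            using slack False psubset.prems(2)[of Y] by (metis le_neq_implies_less psubsetE)
          moreover have "(\<Union>u\<in>Y. L u - {a}) = \<Union>(L ` Y) - {a}" by blast
          ultimately show ?thesis using card_del_ge[of "\<Union>(L ` Y)" a] by simp
        qed simp
      qed
      then obtain d where d: "inj_on d (V - {v})" "\<And>u. u \<in> V - {v} \<Longrightarrow> d u \<in> L u - {a}" by blast
      have "inj_on (d(v := a)) V"
      proof (rule inj_onI)
        fix x y assume "x \<in> V" "y \<in> V" "(d(v := a)) x = (d(v := a)) y"
        then show "x = y"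
          using d(2)[of x] d(2)[of y] inj_onD[OF d(1), of x y] by (auto split: if_splits)
      qed
      moreover have "\<forall>u\<in>V. (d(v := a)) u \<in> L u" using d(2) a by auto
      ultimately show ?thesis by blast
    qed
  qed simp
qed

lemma mcol_small_pot:
  fixes L :: "'a \<Rightarrow> 'c set"
  assumes inf: "infinite (UNIV :: 'c set)"
    and "finite V" and f: "\<And>v. v \<in> V \<Longrightarrow> f v < card V"
    and L: "\<And>v. v \<in> V \<Longrightarrow> finite (L v)" "\<And>v. v \<in> V \<Longrightarrow> f v \<le> card (L v)"
    and small: "\<And>L' :: 'a \<Rightarrow> 'c set. \<lbrakk>\<And>v. v \<in> V \<Longrightarrow> finite (L' v); \<And>v. v \<in> V \<Longrightarrow> f v \<le> card (L' v);
      card (\<Union>(L' ` V)) < card V\<rbrakk> \<Longrightarrow> mcol p V L'"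
  shows "mcol p V L"
proof (cases "\<forall>X\<subseteq>V. card X \<le> card (\<Union>(L ` X))")
  case True
  then obtain c where "inj_on c V" "\<forall>v\<in>V. c v \<in> L v"
    using hall_marriage[OF assms(2), of L] L(1) by blast
  then show ?thesis unfolding mcol_def inj_on_def by metis
next
  case False
  define bad where "bad = {X. X \<subseteq> V \<and> card (\<Union>(L ` X)) < card X}"
  have "finite bad" unfolding bad_def using assms(2) by simp
  moreover have "bad \<noteq> {}" using False unfolding bad_def by (auto simp: not_le)
  ultimately obtain X where X: "X \<in> bad" "\<And>Y. Y \<in> bad \<Longrightarrow> X \<subseteq> Y \<Longrightarrow> X = Y"
    using finite_has_maximal[of bad] by metis
  let ?N = "\<Union>(L ` X)"
  have XV: "X \<subseteq> V" "card ?N < card X" using X(1) unfolding bad_def by auto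
  have fX: "finite X" using XV(1) assms(2) by (rule finite_subset)
  have fN: "finite ?N" using fX XV(1) L(1) by blast
  have "card X \<le> card V" using XV(1) assms(2) by (rule card_mono[rotated])
  then have "card ?N \<le> card V - 1" using XV(2) by linarith
  \<comment> \<open>Fresh colours pad \<open>?N\<close> to exactly \<open>card V - 1\<close>: large
    enough for every bound \<open>f v < card V\<close>, yet smaller than
    \<open>card V\<close>.\<close>
  obtain E where E: "finite E" "card E = card V - 1 - card ?N" "E \<subseteq> UNIV - ?N"
    using infinite_arbitrarily_large[OF Diff_infinite_finite[OF fN inf]] by metis
  have D: "finite (?N \<union> E)" "card (?N \<union> E) = card V - 1"
  proof -
    have "card (?N \<union> E) = card ?N + card E" using E fN by (intro card_Un_disjoint) auto
    then show "finite (?N \<union> E)" "card (?N \<union> E) = card V - 1"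
      using E(1,2) fN \<open>card ?N \<le> card V - 1\<close> by simp_all
  qed
  define L' where "L' v = (if v \<in> X then L v else ?N \<union> E)" for v
  have pot: "card (\<Union>(L' ` V)) < card V"
  proof -
    have "\<Union>(L' ` V) \<subseteq> ?N \<union> E" unfolding L'_def by (auto split: if_splits)
    then have "card (\<Union>(L' ` V)) \<le> card V - 1" using D card_mono by metis
    then show ?thesis using XV(2) \<open>card X \<le> card V\<close> by linarith
  qed
  have "mcol p V L'"
  proof (rule small)
    show "finite (L' v)" if "v \<in> V" for v using L(1)[OF that] D(1) unfolding L'_def by simp
    show "f v \<le> card (L' v)" if "v \<in> V" for v
      using L(2)[OF that] f[OF that] D(2) unfolding L'_def by auto
  qed (rule pot)
  then obtain c where c: "\<And>v. v \<in> V \<Longrightarrow> c v \<in> L' v"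
      "\<And>u v. u \<in> V \<Longrightarrow> v \<in> V \<Longrightarrow> p u \<noteq> p v \<Longrightarrow> c u \<noteq> c v"
    unfolding mcol_def by metis
  have cX: "c v \<in> L v" if "v \<in> X" for v
    using c(1)[of v] that XV(1) unfolding L'_def by auto
  have "\<exists>d. inj_on d (V - X) \<and> (\<forall>v\<in>V - X. d v \<in> L v - ?N)"
  proof (rule hall_marriage)
    show "finite (V - X)" using assms(2) by simp
    show "finite (L v - ?N)" if "v \<in> V - X" for v using L(1) that by blast
    show "card Y \<le> card (\<Union>v\<in>Y. L v - ?N)" if "Y \<subseteq> V - X" for Y
    proof (cases "Y = {}")
      case False
      have fY: "finite Y" using that assms(2) by (meson Diff_subset finite_subset)
      \<comment> \<open>Maximality gives Hall's inequality for \<open>X \<union> Y\<close>; as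
        \<open>?N\<close> has fewer colours than \<open>X\<close> has vertices, enough colours for
        \<open>Y\<close> lie outside \<open>?N\<close>.\<close>
      have "X \<union> Y \<notin> bad" using X(2)[of "X \<union> Y"] that False by blast
      then have "card (X \<union> Y) \<le> card (\<Union>(L ` (X \<union> Y)))"
        using that XV(1) unfolding bad_def by (auto simp: not_less)
      also have "\<Union>(L ` (X \<union> Y)) = ?N \<union> (\<Union>v\<in>Y. L v - ?N)" by auto
      also have "card \<dots> \<le> card ?N + card (\<Union>v\<in>Y. L v - ?N)" by (rule card_Un_le)
      finally have "card (X \<union> Y) \<le> card ?N + card (\<Union>v\<in>Y. L v - ?N)" .
      moreover have "card (X \<union> Y) = card X + card Y"
        using that fX fY by (intro card_Un_disjoint) auto
      ultimately show ?thesis using XV(2) by linarith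
    qed simp
  qed
  then obtain d where d: "inj_on d (V - X)" "\<And>v. v \<in> V - X \<Longrightarrow> d v \<in> L v - ?N" by blast
  let ?e = "\<lambda>v. if v \<in> X then c v else d v"
  have cross: "c a \<noteq> d b" if "a \<in> X" "b \<in> V - X" for a b
    using cX[OF that(1)] d(2)[OF that(2)] that(1) by auto
  have "?e v \<in> L v" if "v \<in> V" for v using cX d(2) that by auto
  moreover have "?e a \<noteq> ?e b" if "a \<in> V" "b \<in> V" "p a \<noteq> p b" for a b
    using that c(2)[of a b] cross[of a b] cross[of b a] inj_onD[OF d(1), of a b] by auto
  ultimately show ?thesis unfolding mcol_def by (intro exI[of _ ?e]) blast
qed

section \<open>Removing the parts of size 2\<close>

text \<open>The parts of size 2 are kept apart from a core \<open>V\<close>, so that an induction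
  can remove them while the core stays fixed.\<close>

definition pairs_outside :: "('a \<Rightarrow> 'b) \<Rightarrow> 'a set \<Rightarrow> 'a set set \<Rightarrow> bool" where
  "pairs_outside p V B \<longleftrightarrow> finite B \<and> disjoint B \<and> \<Union>B \<inter> V = {}
     \<and> (\<forall>b\<in>B. card b = 2 \<and> (\<forall>u\<in>b. \<forall>v\<in>b. p u = p v))"

lemma pairs_outside_subset: "pairs_outside p V B \<Longrightarrow> C \<subseteq> B \<Longrightarrow> W \<subseteq> V \<Longrightarrow> pairs_outside p W C"
  (is "_ \<Longrightarrow> _ \<Longrightarrow> _ \<Longrightarrow> ?thesis")
proof -
  assume *: "pairs_outside p V B" "C \<subseteq> B" "W \<subseteq> V"
  then have "finite C"
    unfolding pairs_outside_def by (metis finite_subset)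
  moreover have "disjoint C"
    using * unfolding pairs_outside_def by (metis pairwise_subset)
  moreover have "\<Union>C \<inter> W = {}"
    using * unfolding pairs_outside_def by fast
  ultimately show ?thesis
    using * unfolding pairs_outside_def by blast
qed

lemma pairs_outside_card:
  assumes "pairs_outside p V B" "finite V"
  shows "finite (V \<union> \<Union>B)" "card (V \<union> \<Union>B) = card V + 2 * card B"
proof -
  have *: "\<And>b. b \<in> B \<Longrightarrow> finite b" "\<And>b. b \<in> B \<Longrightarrow> card b = 2" "disjoint B" "finite B" "\<Union>B \<inter> V = {}"
    using assms(1) unfolding pairs_outside_def by (auto intro: card_ge_0_finite)
  then show "finite (V \<union> \<Union>B)" using assms(2) by blast
  have "card (\<Union>B) = (\<Sum>b\<in>B. card b)"
    using * by (intro card_Union_disjoint) (auto simp: disjoint_def pairwise_def disjnt_def)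
  then have "card (\<Union>B) = 2 * card B" using *(2) by simp
  moreover have "finite (\<Union>B)" using * by blast
  ultimately show "card (V \<union> \<Union>B) = card V + 2 * card B"
    using card_Un_disjoint[of V "\<Union>B"] assms(2) *(5) by (simp add: Int_commute)
qed

text \<open>The two lists of a pair have total size at least \<open>card V + 2 * card B\<close>, the
  number of vertices. With fewer colours than vertices they meet, and a common colour removes the
  pair. Every other list loses at most one colour, just as \<open>card B\<close> drops by
  one.\<close>

lemma pairs_removal:
  fixes L :: "'a \<Rightarrow> 'c set"
  assumes inf: "infinite (UNIV :: 'c set)" and V: "finite V"
    and "pairs_outside p V B"
    and "\<And>b. b \<in> B \<Longrightarrow> card V \<le> sum g b"
    and "\<And>v. v \<in> V \<union> \<Union>B \<Longrightarrow> g v < card V"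
    and base: "\<And>L :: 'a \<Rightarrow> 'c set. (\<And>v. v \<in> V \<Longrightarrow> finite (L v)) \<Longrightarrow> (\<And>v. v \<in> V \<Longrightarrow> g v \<le> card (L v)) \<Longrightarrow> mcol p V L"
    and "\<And>v. v \<in> V \<union> \<Union>B \<Longrightarrow> finite (L v)" "\<And>v. v \<in> V \<union> \<Union>B \<Longrightarrow> g v + card B \<le> card (L v)"
  shows "mcol p (V \<union> \<Union>B) L"
proof -
  have "finite B" using assms(3) unfolding pairs_outside_def by blast
  then show ?thesis using assms(3-5,7,8)
  proof (induction B arbitrary: L)
    case empty
    then show ?case using base[of L] by simp
  next
    case (insert b B)
    let ?W = "V \<union> \<Union>(insert b B)"
    have cW: "finite ?W" "card ?W = card V + 2 * card (insert b B)"
      using pairs_outside_card[OF insert.prems(1) V] by blast+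
    obtain u v where b: "b = {u, v}" "u \<noteq> v" "p u = p v"
      using insert.prems(1) unfolding pairs_outside_def by (metis card_2_iff insertCI)
    show ?case
    proof (rule mcol_small_pot[OF inf cW(1), where f = "\<lambda>v. g v + card (insert b B)"])
      show "g x + card (insert b B) < card ?W" if "x \<in> ?W" for x
        using insert.prems(3)[OF that] cW(2) by simp
      show "finite (L x)" "g x + card (insert b B) \<le> card (L x)" if "x \<in> ?W" for x
        using insert.prems(4,5) that by blast+
    next
      fix L :: "'a \<Rightarrow> 'c set"
      assume L: "\<And>x. x \<in> ?W \<Longrightarrow> finite (L x)" "\<And>x. x \<in> ?W \<Longrightarrow> g x + card (insert b B) \<le> card (L x)"
        and pot: "card (\<Union>(L ` ?W)) < card ?W"
      have uv: "u \<in> ?W" "v \<in> ?W" using b by blast+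
      have "L u \<inter> L v \<noteq> {}"
      proof
        assume "L u \<inter> L v = {}"
        then have "card (L u) + card (L v) = card (L u \<union> L v)"
          using L(1)[OF uv(1)] L(1)[OF uv(2)] by (simp add: card_Un_disjoint)
        also have "\<dots> \<le> card (\<Union>(L ` ?W))"
          using uv L(1) cW(1) by (intro card_mono) blast+
        finally have "card (L u) + card (L v) < card ?W" using pot by linarith
        moreover have "card V \<le> g u + g v" using insert.prems(2)[of b] b by simp
        ultimately show False using L(2)[OF uv(1)] L(2)[OF uv(2)] cW(2) by linarith
      qed
      then obtain c where c: "c \<in> L u" "c \<in> L v" by blast
      have "mcol p (V \<union> \<Union>B) (\<lambda>v. L v - {c})"
      proof (rule insert.IH)
        show "pairs_outside p V B" by (rule pairs_outside_subset[OF insert.prems(1)]) auto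
        show "finite (L x - {c})" if "x \<in> V \<union> \<Union>B" for x using L(1)[of x] that by blast
        show "g x + card B \<le> card (L x - {c})" if "x \<in> V \<union> \<Union>B" for x
        proof -
          have "g x + card (insert b B) \<le> card (L x)" using L(2)[of x] that by blast
          then show ?thesis using insert.hyps card_del_ge[of "L x" c] by simp
        qed
        show "card V \<le> sum g a" if "a \<in> B" for a using insert.prems(2) that by blast
        show "g x < card V" if "x \<in> V \<union> \<Union>B" for x using insert.prems(3) that by blast
      qed
      then show "mcol p ?W L"
        by (rule mcol_step[where I = "{u, v}"]) (use b c in auto)
    qed
  qed
qed

text \<open>The constant 4 for \<open>g\<close> fits the core of eight vertices:
  \<open>4 + 4 = 8\<close> on each pair, and \<open>two_triples_two\<close> colours the
  core.\<close>

lemma two_triples_pairs: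
  fixes L :: "'a \<Rightarrow> 'c set"
  assumes inf: "infinite (UNIV :: 'c set)"
    and V: "V = {x, y, z, x', y', z', s, t}" "card V = 8"
    and p: "p x = p y" "p y = p z" "p x' = p y'" "p y' = p z'"
    and B: "pairs_outside p V B"
    and L: "\<And>v. v \<in> V \<union> \<Union>B \<Longrightarrow> finite (L v)" "\<And>v. v \<in> V \<union> \<Union>B \<Longrightarrow> card B + 4 \<le> card (L v)"
  shows "mcol p (V \<union> \<Union>B) L"
proof (rule pairs_removal[OF inf, where g = "\<lambda>_. 4"])
  show "finite V" using V(1) by simp
  show "card V \<le> sum (\<lambda>_. 4) b" if "b \<in> B" for b
    using that B V(2) unfolding pairs_outside_def by simp
  show "mcol p V L" if "\<And>v. v \<in> V \<Longrightarrow> 4 \<le> card (L v)" for L :: "'a \<Rightarrow> 'c set"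
  proof -
    have "4 \<le> card (L x)" "4 \<le> card (L y)" "4 \<le> card (L z)" "4 \<le> card (L x')"
      "4 \<le> card (L y')" "4 \<le> card (L z')" "4 \<le> card (L s)" "4 \<le> card (L t)"
      using that V(1) by simp_all
    then show ?thesis
      unfolding V(1) by (intro two_triples_two p) (simp_all add: tri_def)
  qed
qed (use V(2) B L in \<open>simp_all add: add.commute\<close>)

text \<open>This is the instance after \<open>c\<close> has been used on two vertices of a triple,
  with \<open>w\<close> the third one. Since \<open>c\<close> misses a vertex of every pair and
  every triple, pairs keep \<open>4 + 5 = 9 = card V\<close> and triples keep the total
  \<open>4 + 4 + 5 = 13\<close>.\<close>

lemma two_triples_pairs_merged:
  fixes L :: "'a \<Rightarrow> 'c set"
  assumes inf: "infinite (UNIV :: 'c set)"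
    and V: "V = {x, y, z, x', y', z', s, t, w}" "card V = 9"
    and p: "p x = p y" "p y = p z" "p x' = p y'" "p y' = p z'"
    and B: "pairs_outside p V B"
    and L: "\<And>v. v \<in> V \<union> \<Union>B \<Longrightarrow> finite (L v)" "\<And>v. v \<in> V \<union> \<Union>B \<Longrightarrow> card B + 5 \<le> card (L v)"
    and c: "c \<notin> L w" "\<not> (c \<in> L x \<and> c \<in> L y \<and> c \<in> L z)" "\<not> (c \<in> L x' \<and> c \<in> L y' \<and> c \<in> L z')"
      "\<And>b. b \<in> B \<Longrightarrow> \<exists>v\<in>b. c \<notin> L v"
  shows "mcol p (V \<union> \<Union>B) (\<lambda>v. L v - {c})"
proof -
  \<comment> \<open>A uniform bound 4 would be too weak on the pairs, so \<open>g\<close> records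
    which lists actually contain \<open>c\<close>.\<close>
  define g :: "'a \<Rightarrow> nat" where "g v = (if c \<in> L v then 4 else 5)" for v
  have g4: "4 \<le> g v" "g v \<le> 5" for v unfolding g_def by auto
  show ?thesis
  proof (rule pairs_removal[OF inf, where g = g])
    show "finite V" using V(1) by simp
    show "pairs_outside p V B" by (rule B)
    show "card V \<le> sum g b" if b: "b \<in> B" for b
    proof -
      obtain v where v: "v \<in> b" "c \<notin> L v" using c(4)[OF b] by blast
      have "card b = 2" using B b unfolding pairs_outside_def by blast
      then obtain u where "b = {v, u}" "u \<noteq> v" using v(1) by (metis card_2_iff insert_commute insertE singletonD)
      then show ?thesis using V(2) v(2) g4(1)[of u] by (simp add: g_def[of v])
    qed
    show "g v < card V" for v using g4(2)[of v] V(2) by linarith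
    show "finite (L v - {c})" if "v \<in> V \<union> \<Union>B" for v using L(1)[OF that] by blast
    show "g v + card B \<le> card (L v - {c})" if "v \<in> V \<union> \<Union>B" for v
      using L(2)[OF that] card_del_ge[of "L v" c] unfolding g_def by auto
    show "mcol p V M" if M: "\<And>v. v \<in> V \<Longrightarrow> g v \<le> card (M v)" for M :: "'a \<Rightarrow> 'c set"
    proof -
      have tri: "tri M 4 8 13 a b d"
        if "{a, b, d} \<subseteq> V" "\<not> (c \<in> L a \<and> c \<in> L b \<and> c \<in> L d)" for a b d
      proof -
        have "13 \<le> g a + g b + g d" using that(2) unfolding g_def by auto
        then show ?thesis
          using M[of a] M[of b] M[of d] g4(1)[of a] g4(1)[of b] g4(1)[of d] that(1)
          unfolding tri_def by simp
      qed
      have "tri M 4 8 13 x y z" "tri M 4 8 13 x' y' z'"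
        by (rule tri[OF _ c(2)], use V(1) in simp, rule tri[OF _ c(3)], use V(1) in simp)
      moreover have "4 \<le> card (M s)" "4 \<le> card (M t)" "5 \<le> card (M w)"
        using M[of s] M[of t] M[of w] g4(1)[of s] g4(1)[of t] c(1) V(1) by (simp_all add: g_def[of w])
      ultimately show ?thesis
        unfolding V(1) by (intro two_triples_three p)
    qed
  qed
qed

section \<open>Three triples with pairs and two single vertices\<close>

text \<open>Here \<open>k\<close> is \<open>card B + 5\<close>. The induction on \<open>B\<close>
  serves only the case of a pair with a common colour; in the other cases the lemmas on two triples
  remove all pairs themselves.\<close>

lemma three_triples_pairs:
  fixes L :: "'a \<Rightarrow> 'c set"
  assumes inf: "infinite (UNIV :: 'c set)"
    and dist: "distinct [x1, x2, x3, y1, y2, y3, z1, z2, z3, s, t]"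
    and p: "p x1 = p x2" "p x2 = p x3" "p y1 = p y2" "p y2 = p y3" "p z1 = p z2" "p z2 = p z3"
    and V: "V = {x1, x2, x3, y1, y2, y3, z1, z2, z3, s, t}"
    and B: "pairs_outside p V B"
    and L: "\<And>v. v \<in> V \<union> \<Union>B \<Longrightarrow> finite (L v)" "\<And>v. v \<in> V \<union> \<Union>B \<Longrightarrow> card B + 5 \<le> card (L v)"
  shows "mcol p (V \<union> \<Union>B) L"
proof -
  have fV: "finite V" and cV: "card V = 11" using dist unfolding V by simp_all
  have "finite B" using B unfolding pairs_outside_def by blast
  then show ?thesis using B L
  proof (induction B arbitrary: L rule: finite_psubset_induct)
    case (psubset B)
    let ?W = "V \<union> \<Union>B"
    have cW: "finite ?W" "card ?W = 11 + 2 * card B"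
      using pairs_outside_card[OF psubset.prems(1) fV] cV by simp_all
    show ?case
    proof (rule mcol_small_pot[OF inf cW(1), where f = "\<lambda>v. card B + 5"])
      show "card B + 5 < card ?W" using cW(2) by simp
      show "finite (L v)" "card B + 5 \<le> card (L v)" if "v \<in> ?W" for v
        using psubset.prems(2,3) that by blast+
    next
      fix L :: "'a \<Rightarrow> 'c set"
      assume L: "\<And>v. v \<in> ?W \<Longrightarrow> finite (L v)" "\<And>v. v \<in> ?W \<Longrightarrow> card B + 5 \<le> card (L v)"
        and pot: "card (\<Union>(L ` ?W)) < card ?W"
      \<comment> \<open>Stated for arbitrary names so that each of the three triples can play the
        part of \<open>a\<close>, \<open>b\<close>, \<open>d\<close>; the core \<open>U\<close>
        consists of the other two and the single vertices.\<close>
      have full: "mcol p ?W L"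
        if W: "?W \<subseteq> {a, b, d} \<union> (U \<union> \<Union>B)" "U = {x, y, z, x', y', z', s, t}" "card U = 8" "U \<subseteq> V"
          and q: "p a = p b" "p b = p d" "p x = p y" "p y = p z" "p x' = p y'" "p y' = p z'"
          and c: "c \<in> L a" "c \<in> L b" "c \<in> L d" for a b d x y z x' y' z' c U
      proof -
        have "mcol p (U \<union> \<Union>B) (\<lambda>v. L v - {c})"
        proof (rule two_triples_pairs[where p = p, OF inf W(2,3) q(3-6)])
          show "pairs_outside p U B" by (rule pairs_outside_subset[OF psubset.prems(1) _ W(4)]) simp
          show "finite (L v - {c})" if "v \<in> U \<union> \<Union>B" for v using L(1)[of v] that W(4) by blast
          show "card B + 4 \<le> card (L v - {c})" if "v \<in> U \<union> \<Union>B" for v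
          proof -
            have "card B + 5 \<le> card (L v)" using L(2)[of v] that W(4) by blast
            then show ?thesis using card_del_ge[of "L v" c] by linarith
          qed
        qed
        then show ?thesis
          by (rule mcol_step[where I = "{a, b, d}"]) (use W(1) q(1,2) c in auto)
      qed
      consider (B) b c where "b \<in> B" "\<And>v. v \<in> b \<Longrightarrow> c \<in> L v"
        | (X) c where "c \<in> L x1" "c \<in> L x2" "c \<in> L x3"
        | (Y) c where "c \<in> L y1" "c \<in> L y2" "c \<in> L y3"
        | (Z) c where "c \<in> L z1" "c \<in> L z2" "c \<in> L z3"
        | (no) "\<And>b c. b \<in> B \<Longrightarrow> \<exists>v\<in>b. c \<notin> L v" "\<And>c. \<not> (c \<in> L x1 \<and> c \<in> L x2 \<and> c \<in> L x3)"
          "\<And>c. \<not> (c \<in> L y1 \<and> c \<in> L y2 \<and> c \<in> L y3)" "\<And>c. \<not> (c \<in> L z1 \<and> c \<in> L z2 \<and> c \<in> L z3)"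
        by blast
      then show "mcol p ?W L"
      proof cases
        case (B b c)
        have "mcol p (V \<union> \<Union>(B - {b})) (\<lambda>v. L v - {c})"
        proof (rule psubset.IH)
          show "B - {b} \<subset> B" using B(1) by blast
          show "pairs_outside p V (B - {b})" by (rule pairs_outside_subset[OF psubset.prems(1)]) auto
          show "finite (L v - {c})" if "v \<in> V \<union> \<Union>(B - {b})" for v using L(1)[of v] that by blast
          show "card (B - {b}) + 5 \<le> card (L v - {c})" if "v \<in> V \<union> \<Union>(B - {b})" for v
          proof -
            have "card B + 5 \<le> card (L v)" using L(2)[of v] that by blast
            moreover have "card B = card (B - {b}) + 1"
              using B(1) psubset.hyps(1) by (metis Suc_eq_plus1 card_Suc_Diff1)
            ultimately show ?thesis using card_del_ge[of "L v" c] by linarith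
          qed
        qed
        then show ?thesis
        proof (rule mcol_step[where I = b])
          show "p u = p v" if "u \<in> b" "v \<in> b" for u v
            using psubset.prems(1) B(1) that unfolding pairs_outside_def by blast
        qed (use B in auto)
      next
        case X
        show ?thesis
          by (rule full[OF _ refl _ _ p X]) (use dist V in auto)
      next
        case Y
        show ?thesis
          by (rule full[OF _ refl _ _ p(3,4,1,2,5,6) Y]) (use dist V in auto)
      next
        case Z
        show ?thesis
          by (rule full[OF _ refl _ _ p(5,6,1,2,3,4) Z]) (use dist V in auto)
      next
        case no
        \<comment> \<open>The uncoloured vertex \<open>w\<close> joins \<open>s\<close> and
          \<open>t\<close> as a third single vertex, which gives a core of nine vertices.\<close>
        have merge: "mcol p ?W L"
          if "c \<in> L u" "c \<in> L v" "c \<notin> L w" "{u, v, w} = {x1, x2, x3}" for u v w c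
        proof -
          let ?U = "{y1, y2, y3, z1, z2, z3, s, t, w}"
          have m: "u \<in> {x1, x2, x3}" "v \<in> {x1, x2, x3}" "w \<in> {x1, x2, x3}" using that(4) by blast+
          have UV: "?U \<subseteq> V" using m(3) unfolding V by blast
          have "card ?U = 9" using dist m(3) by auto
          then have col: "mcol p (?U \<union> \<Union>B) (\<lambda>v. L v - {c})"
          proof (rule two_triples_pairs_merged[where p = p, OF inf refl _ p(3-6)])
            show "pairs_outside p ?U B" by (rule pairs_outside_subset[OF psubset.prems(1) _ UV]) simp
            show "finite (L a)" if "a \<in> ?U \<union> \<Union>B" for a using L(1)[of a] that UV by blast
            show "card B + 5 \<le> card (L a)" if "a \<in> ?U \<union> \<Union>B" for a using L(2)[of a] that UV by blast
          qed (use that(3) no in blast)+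
          show ?thesis
          proof (rule mcol_step[OF col])
            have "V = {x1, x2, x3} \<union> {y1, y2, y3, z1, z2, z3, s, t}" unfolding V by blast
            then show "?W \<subseteq> ?U \<union> \<Union>B \<union> {u, v}" unfolding that(4)[symmetric] by blast
            show "c \<in> L a" if "a \<in> {u, v}" for a
              using that \<open>c \<in> L u\<close> \<open>c \<in> L v\<close> by blast
            show "p a = p b" if "a \<in> {u, v}" "b \<in> {u, v}" for a b
            proof -
              have "a \<in> {x1, x2, x3}" "b \<in> {x1, x2, x3}" using that m by blast+
              then show ?thesis using p by auto
            qed
          qed
        qed
        have xW: "x1 \<in> ?W" "x2 \<in> ?W" "x3 \<in> ?W" unfolding V by blast+
        \<comment> \<open>Three disjoint lists would need \<open>3 * (card B + 5)\<close> colours,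
          more than the number \<open>11 + 2 * card B\<close> of vertices.\<close>
        have "L x1 \<inter> L x2 \<noteq> {} \<or> L x1 \<inter> L x3 \<noteq> {} \<or> L x2 \<inter> L x3 \<noteq> {}"
        proof (rule ccontr)
          assume "\<not> ?thesis"
          then have "card (L x1 \<union> L x2 \<union> L x3) = card (L x1) + card (L x2) + card (L x3)"
            using L(1)[OF xW(1)] L(1)[OF xW(2)] L(1)[OF xW(3)]
            by (simp add: card_Un_disjoint Int_Un_distrib2)
          moreover have "card (L x1 \<union> L x2 \<union> L x3) \<le> card (\<Union>(L ` ?W))"
            using xW L(1) cW(1) by (intro card_mono) blast+
          ultimately show False
            using pot cW(2) L(2)[OF xW(1)] L(2)[OF xW(2)] L(2)[OF xW(3)] by linarith
        qed
        then consider c where "c \<in> L x1" "c \<in> L x2" | c where "c \<in> L x1" "c \<in> L x3"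
          | c where "c \<in> L x2" "c \<in> L x3" by blast
        then show ?thesis
        proof cases
          case (1 c)
          then show ?thesis using no(2)[of c] by (intro merge[of c x1 x2 x3]) blast+
        next
          case (2 c)
          then show ?thesis using no(2)[of c] by (intro merge[of c x1 x3 x2]) blast+
        next
          case (3 c)
          then show ?thesis using no(2)[of c] by (intro merge[of c x2 x3 x1]) blast+
        qed
      qed
    qed
  qed
qed

section \<open>Transfer to complete multipartite graphs and the choice number\<close>

lemma count_image_mset_set:
  "finite P \<Longrightarrow> count (image_mset f (mset_set P)) n = card {A \<in> P. f A = n}"
proof (induction P rule: finite_induct)
  case (insert A P)
  have "{B \<in> insert A P. f B = n} = (if f A = n then insert A {B \<in> P. f B = n} else {B \<in> P. f B = n})"
    by auto
  then show ?case using insert by simp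
qed simp

lemma complete_multipartiteE:
  assumes "complete_multipartite S G"
  obtains P where "graph G" "partition_on (verts G) P" "image_mset card (mset_set P) = S"
    "\<forall>A\<in>P. \<forall>B\<in>P. \<forall>u\<in>A. \<forall>v\<in>B. u \<rightarrow>\<^bsub>G\<^esub> v \<longleftrightarrow> A \<noteq> B"
  using assms unfolding complete_multipartite_def by blast

text \<open>Give all vertices the same \<open>j\<close> colours: representatives of the parts are
  pairwise adjacent, so they need distinct colours.\<close>

lemma complete_multipartite_choosable_ge:
  assumes "complete_multipartite S G" "choosable j G"
  shows "size S \<le> j"
proof -
  obtain P where "graph G" and P: "partition_on (verts G) P" "image_mset card (mset_set P) = S"
      "\<forall>A\<in>P. \<forall>B\<in>P. \<forall>u\<in>A. \<forall>v\<in>B. u \<rightarrow>\<^bsub>G\<^esub> v \<longleftrightarrow> A \<noteq> B"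
    using assms(1) by (rule complete_multipartiteE)
  interpret graph G by fact
  have "list_assignment j G (\<lambda>_. {..<j})" unfolding list_assignment_def by simp
  then obtain c where c: "\<And>u. u \<in> verts G \<Longrightarrow> c u < j" "\<And>u v. u \<rightarrow>\<^bsub>G\<^esub> v \<Longrightarrow> c u \<noteq> c v"
    using assms(2) unfolding choosable_def list_colorable_def list_coloring_def by fastforce
  define r where "r A = (SOME v. v \<in> A)" for A :: "'a set"
  have r: "r A \<in> A" "r A \<in> verts G" if "A \<in> P" for A
  proof -
    have "A \<noteq> {}" using P(1) that unfolding partition_on_def by blast
    then show "r A \<in> A" unfolding r_def by (simp add: some_in_eq)
    then show "r A \<in> verts G" using P(1) that unfolding partition_on_def by blast
  qed
  have "inj_on (\<lambda>A. c (r A)) P"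
  proof (rule inj_onI, rule ccontr)
    fix A B assume AB: "A \<in> P" "B \<in> P" "c (r A) = c (r B)" "A \<noteq> B"
    then have "r A \<rightarrow>\<^bsub>G\<^esub> r B"
      using P(3) r(1)[OF AB(1)] r(1)[OF AB(2)] by blast
    then show False using c(2) AB(3) by blast
  qed
  then have "card P \<le> card {..<j}"
    using c(1) r(2) by (intro card_inj_on_le) auto
  moreover have "size S = card P"
    unfolding P(2)[symmetric] by simp
  ultimately show ?thesis by simp
qed

lemma three_triples_choosable:
  assumes "complete_multipartite
      (replicate_mset 3 3 + replicate_mset m 2 + replicate_mset 2 1) G"
  shows "choosable (m + 5) G"
  unfolding choosable_def
proof (intro allI impI)
  fix L :: "'a \<Rightarrow> nat set"
  assume L: "list_assignment (m + 5) G L"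
  obtain P where "graph G" and P: "partition_on (verts G) P"
      "image_mset card (mset_set P) = replicate_mset 3 3 + replicate_mset m 2 + replicate_mset 2 1"
      "\<forall>A\<in>P. \<forall>B\<in>P. \<forall>u\<in>A. \<forall>v\<in>B. u \<rightarrow>\<^bsub>G\<^esub> v \<longleftrightarrow> A \<noteq> B"
    using assms by (rule complete_multipartiteE)
  interpret graph G by fact
  have UP: "\<Union>P = verts G" and disj: "disjoint P"
    using P(1) unfolding partition_on_def by blast+
  have fP: "finite P" using UP finite_verts finite_UnionD by metis
  have count: "card {A \<in> P. card A = n} =
      count (replicate_mset 3 3 + replicate_mset m 2 + replicate_mset 2 1) n" for n
    unfolding P(2)[symmetric] by (rule count_image_mset_set[OF fP, symmetric])
  have "card {A \<in> P. card A = 3} = 3" "card {A \<in> P. card A = 1} = 2"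
    and cB: "card {A \<in> P. card A = 2} = m"
    unfolding count by simp_all
  then obtain X Y Z S T where XYZ: "{A \<in> P. card A = 3} = {X, Y, Z}" "X \<noteq> Y" "X \<noteq> Z" "Y \<noteq> Z"
    and ST: "{A \<in> P. card A = 1} = {S, T}" "S \<noteq> T"
    unfolding card_3_iff card_2_iff by metis
  let ?B = "{A \<in> P. card A = 2}"
  have inP: "X \<in> P" "Y \<in> P" "Z \<in> P" "S \<in> P" "T \<in> P" using XYZ(1) ST(1) by blast+
  have cards: "card X = 3" "card Y = 3" "card Z = 3" "card S = 1" "card T = 1"
    using XYZ(1) ST(1) by blast+
  obtain x1 x2 x3 where x: "X = {x1, x2, x3}" "x1 \<noteq> x2" "x1 \<noteq> x3" "x2 \<noteq> x3"
    using cards(1) unfolding card_3_iff by metis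
  obtain y1 y2 y3 where y: "Y = {y1, y2, y3}" "y1 \<noteq> y2" "y1 \<noteq> y3" "y2 \<noteq> y3"
    using cards(2) unfolding card_3_iff by metis
  obtain z1 z2 z3 where z: "Z = {z1, z2, z3}" "z1 \<noteq> z2" "z1 \<noteq> z3" "z2 \<noteq> z3"
    using cards(3) unfolding card_3_iff by metis
  obtain s t where st: "S = {s}" "T = {t}"
    using cards(4,5) by (meson card_1_singletonE)
  let ?V = "{x1, x2, x3, y1, y2, y3, z1, z2, z3, s, t}"
  have V: "?V = X \<union> Y \<union> Z \<union> S \<union> T" unfolding x y z st by auto
  have dj: "A \<inter> B = {}" if "A \<in> P" "B \<in> P" "A \<noteq> B" for A B
    using disj that by (rule disjointD)
  have ne: "A \<noteq> B" if "card A \<noteq> card B" for A B :: "'a set" using that by blast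
  have int: "X \<inter> Y = {}" "X \<inter> Z = {}" "Y \<inter> Z = {}" "X \<inter> S = {}" "X \<inter> T = {}"
    "Y \<inter> S = {}" "Y \<inter> T = {}" "Z \<inter> S = {}" "Z \<inter> T = {}" "S \<inter> T = {}"
    by (rule dj; use inP XYZ ST cards in \<open>simp add: ne\<close>)+
  have "finite X" "finite Y" "finite Z" "finite S" "finite T"
    unfolding x y z st by simp_all
  then have "card (X \<union> Y \<union> Z \<union> S \<union> T) = 11"
    using cards int by (simp add: card_Un_disjoint Int_Un_distrib2)
  then have dist: "distinct [x1, x2, x3, y1, y2, y3, z1, z2, z3, s, t]"
    unfolding V[symmetric] by (intro card_distinct) simp
  \<comment> \<open>The part containing \<open>v\<close>, unique by disjointness, serves as the map
    whose fibres are the parts.\<close>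
  define p where "p v = (THE A. A \<in> P \<and> v \<in> A)" for v
  have p: "p v = A" if "A \<in> P" "v \<in> A" for v A
    unfolding p_def using that dj by (intro the_equality) blast+
  have covers: "verts G = ?V \<union> \<Union>?B"
  proof -
    \<comment> \<open>No other sizes occur in the multiset, so the five named parts and
      \<open>?B\<close> exhaust \<open>P\<close>.\<close>
    have "card A \<in> {1, 2, 3}" if "A \<in> P" for A
    proof -
      have "card A \<in># image_mset card (mset_set P)" using that fP by simp
      then show ?thesis unfolding P(2) by (auto split: if_splits)
    qed
    then have "P = {X, Y, Z} \<union> {S, T} \<union> ?B" unfolding XYZ(1)[symmetric] ST(1)[symmetric] by blast
    then have "\<Union>P = X \<union> Y \<union> Z \<union> S \<union> T \<union> \<Union>?B" by blast
    then show ?thesis unfolding UP V .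
  qed
  \<comment> \<open>Lists may be infinite; shrinking them to exactly \<open>m + 5\<close> colours
    supplies the finiteness used by the counting arguments.\<close>
  have "\<exists>T. T \<subseteq> L u \<and> finite T \<and> card T = m + 5" if "u \<in> verts G" for u
  proof (cases "finite (L u)")
    case True
    then have "m + 5 \<le> card (L u)" using L that unfolding list_assignment_def by blast
    then show ?thesis by (meson obtain_subset_with_card_n)
  next
    case False
    then show ?thesis using infinite_arbitrarily_large by metis
  qed
  then obtain M where M: "\<And>u. u \<in> verts G \<Longrightarrow> M u \<subseteq> L u"
      "\<And>u. u \<in> verts G \<Longrightarrow> finite (M u)" "\<And>u. u \<in> verts G \<Longrightarrow> card (M u) = m + 5"
    by metis
  have "mcol p (?V \<union> \<Union>?B) M"
  proof (rule three_triples_pairs[OF infinite_UNIV_nat dist _ _ _ _ _ _ refl])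
    show "p x1 = p x2" "p x2 = p x3" using p[OF inP(1)] unfolding x(1) by simp_all
    show "p y1 = p y2" "p y2 = p y3" using p[OF inP(2)] unfolding y(1) by simp_all
    show "p z1 = p z2" "p z2 = p z3" using p[OF inP(3)] unfolding z(1) by simp_all
    have "b \<inter> A = {}" if "b \<in> ?B" "A \<in> {X, Y, Z, S, T}" for A b
      using that inP cards by (intro dj) auto
    then have "\<Union>?B \<inter> ?V = {}" unfolding V by blast
    moreover have "p u = p v" if "b \<in> ?B" "u \<in> b" "v \<in> b" for b u v
      using that p[of b u] p[of b v] by simp
    moreover have "finite ?B" using fP by simp
    moreover have "disjoint ?B" using disj by (rule pairwise_subset) blast
    ultimately show "pairs_outside p ?V ?B"
      unfolding pairs_outside_def by blast
    show "finite (M v)" "card ?B + 5 \<le> card (M v)" if "v \<in> ?V \<union> \<Union>?B" for v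
      using M(2,3) that unfolding covers[symmetric] cB by auto
  qed
  then obtain c where c: "\<And>v. v \<in> verts G \<Longrightarrow> c v \<in> M v"
      "\<And>u v. u \<in> verts G \<Longrightarrow> v \<in> verts G \<Longrightarrow> p u \<noteq> p v \<Longrightarrow> c u \<noteq> c v"
    unfolding mcol_def covers[symmetric] by metis
  have "c u \<noteq> c v" if uv: "u \<rightarrow>\<^bsub>G\<^esub> v" for u v
  proof -
    have "u \<in> verts G" "v \<in> verts G" using uv by auto
    moreover from this obtain A B where AB: "A \<in> P" "u \<in> A" "B \<in> P" "v \<in> B"
      unfolding UP[symmetric] by blast
    moreover have "A \<noteq> B" using P(3) uv AB by blast
    ultimately show ?thesis using p[of A u] p[of B v] c(2) by simp
  qed
  then have "list_coloring G L c" using c(1) M(1) unfolding list_coloring_def by blast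
  then show "list_colorable G L" unfolding list_colorable_def by blast
qed

theorem theorem4p1:
  fixes G :: "('a, 'b) pre_digraph" and k :: nat
  assumes "k \<ge> 5"
    and "complete_multipartite
           (replicate_mset 3 3 + replicate_mset (k - 5) 2 + replicate_mset 2 1) G"
  shows "choice_number G = k"
  unfolding choice_number_def
proof (rule Least_equality)
  \<comment> \<open>By \<open>k \<ge> 5\<close> the truncated subtraction is exact:
    \<open>(k - 5) + 5\<close> here and the number of parts \<open>3 + (k - 5) + 2\<close> below
    both equal \<open>k\<close>.\<close>
  show "choosable k G"
    using three_triples_choosable[OF assms(2)] assms(1) by simp
  show "k \<le> j" if "choosable j G" for j
    using complete_multipartite_choosable_ge[OF assms(2) that] assms(1) by simp
qed

end
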